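(* Let $D$ be an $n$-vertex eulerian digraph such that $\delta(D_{\mathrm{us}})\ge (4n+2)/5$, where $\delta(D_{\mathrm{us}})$ is the minimum degree of the underlying simple undirected graph $D_{\mathrm{us}}$ of $D$. Let $\mathcal{C}$ be a directed circuit decomposition of $D$. Then there is a directed embedding of $D$ in an oriented surface (i.e., an orientable surface with a specific orientation) with the elements of $\mathcal{C}$ as the profaces and with exactly one or two antifaces, depending on whether $|V(D)|+|A(D)|+|\mathcal{C}|$ is odd or even, respectively. Moreover, this embedding has maximum genus among all orientable directed embeddings of $D$ in which all elements of $\mathcal{C}$ are faces.
   Context: Digraphs are finite and may have loops and multiple arcs; $V(D)$ and $A(D)$ are the sets of vertices and arcs. An eulerian digraph is a connected digraph in which every vertex has indegree equal to outdegree. $D_{\mathrm{us}}$ is the simple undirected graph on $V(D)$ in which distinct $u,v$ are adjacent if and only if there is an arc of $D$ (in either direction) between $u$ and $v$. A directed circuit is a closed directed walk with no repeated arc (vertices may repeat) and at least one arc, considered up to cyclic shift. A directed circuit decomposition of $D$ is a collection of directed circuits that together use every arc of $D$ exactly once. All embeddings are cellular embeddings in closed surfaces; a face is identified with its facial boundary walk. A directed embedding of $D$ is an embedding in which every face is bounded by a directed closed walk of $D$; equivalently, the half-arcs around each vertex, in rotational order, alternate between entering and leaving. An oriented embedding is an embedding in an orientable surface with a chosen global clockwise orientation. In an oriented directed embedding each face is either a proface (facial walk directed clockwise) or an antiface (facial walk directed anticlockwise). Combinatorially, an oriented directed embedding is given by a clockwise cyclic order, alternating in direction, of the half-arcs at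 each vertex; a proface entering a vertex on an incoming half-arc $h$ leaves on the half-arc immediately preceding $h$ in the clockwise order, and an antiface entering on $h$ leaves on the half-arc immediately following $h$. Every arc lies on exactly one proface and exactly one antiface. *)

theory Defs
  imports Complex_Main "HOL-Combinatorics.Cycles" "Graph_Theory.Graph_Theory"
begin

section \<open>Eulerian digraphs and the underlying simple graph\<close>

text \<open>
  Digraphs are finite and may have loops and multiple arcs (locale \<^locale>\<open>fin_digraph\<close>).
  Graph-theoretic connectedness is written with its theory name because of the topological
  constant of the same name; it includes that the vertex set is nonempty.
\<close>

definition eulerian_digraph :: "('a, 'b) pre_digraph \<Rightarrow> bool" where
  "eulerian_digraph D \<longleftrightarrow>
     fin_digraph D \<and> Digraph_Component.connected D \<and>
     (\<forall>v \<in> verts D. in_degree D v = out_degree D v)"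

text \<open>
  A simple undirected graph is represented as in the library (locale \<^locale>\<open>pair_graph\<close>):
  an edge \<open>uv\<close> is the pair of opposite arcs \<open>(u, v)\<close>, \<open>(v, u)\<close>.
\<close>

definition underlying_simple :: "('a, 'b) pre_digraph \<Rightarrow> 'a pair_pre_digraph" where
  "underlying_simple D =
     \<lparr> pverts = verts D, parcs = {(u, v). (u, v) \<in> parcs (mk_symmetric D) \<and> u \<noteq> v} \<rparr>"

lemma pair_graph_underlying_simple:
  assumes "fin_digraph D"
  shows "pair_graph (underlying_simple D)"
proof -
  interpret fin_digraph D by fact
  have "parcs (underlying_simple D) \<subseteq> verts D \<times> verts D"
    by (auto simp: underlying_simple_def mk_symmetric_def)
  then have "finite (parcs (underlying_simple D))"
    by (rule finite_subset) simp
  then show ?thesis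
    by unfold_locales
      (auto simp: underlying_simple_def mk_symmetric_def symmetric_def intro!: symI)
qed

text \<open>For a graph given by opposite arcs, the degree of a vertex is its outdegree.\<close>

definition min_degree :: "'a pair_pre_digraph \<Rightarrow> nat" where
  "min_degree G = Min (out_degree (with_proj G) ` pverts G)"


section \<open>Directed circuits\<close>

definition cyclic_class :: "'b list \<Rightarrow> 'b list set" where
  "cyclic_class p = {rotate k p | k. True}"

definition directed_circuit :: "('a, 'b) pre_digraph \<Rightarrow> 'b list set \<Rightarrow> bool" where
  "directed_circuit D c \<longleftrightarrow>
     (\<exists>u p. pre_digraph.trail D u p u \<and> p \<noteq> [] \<and> c = cyclic_class p)"

definition circuit_arcs :: "'b list set \<Rightarrow> 'b set" where
  "circuit_arcs c = (\<Union>p \<in> c. set p)"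

text \<open>
  A set suffices for the collection: a circuit has at least one arc, so it cannot occur twice.
\<close>

definition circuit_decomposition :: "('a, 'b) pre_digraph \<Rightarrow> 'b list set set \<Rightarrow> bool" where
  "circuit_decomposition D C \<longleftrightarrow>
     (\<forall>c \<in> C. directed_circuit D c) \<and>
     (\<forall>a \<in> arcs D. \<exists>!c. c \<in> C \<and> a \<in> circuit_arcs c)"


section \<open>Oriented directed embeddings\<close>

text \<open>
  The arc \<open>a\<close> consists of the half-arc \<open>Leaving a\<close> at its tail and the half-arc \<open>Entering a\<close>
  at its head; for a loop these are two different half-arcs at the same vertex.
\<close>

datatype 'b half_arc = Leaving (arc_of: 'b) | Entering (arc_of: 'b)

primrec half_arc_vertex :: "('a, 'b) pre_digraph \<Rightarrow> 'b half_arc \<Rightarrow> 'a" where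
  "half_arc_vertex D (Leaving a) = tail D a"
| "half_arc_vertex D (Entering a) = head D a"

definition half_arcs :: "('a, 'b) pre_digraph \<Rightarrow> 'b half_arc set" where
  "half_arcs D = Leaving ` arcs D \<union> Entering ` arcs D"

definition half_arcs_at :: "('a, 'b) pre_digraph \<Rightarrow> 'a \<Rightarrow> 'b half_arc set" where
  "half_arcs_at D v = {h \<in> half_arcs D. half_arc_vertex D h = v}"

text \<open>
  The cyclic orders at all vertices are given by one permutation \<open>\<rho>\<close>: \<open>\<rho> h\<close> is the half-arc
  immediately following \<open>h\<close> in the clockwise order at the vertex of \<open>h\<close>, and \<open>inv \<rho> h\<close> the
  one immediately preceding it.
\<close>

definition oriented_directed_embedding ::
    "('a, 'b) pre_digraph \<Rightarrow> ('b half_arc \<Rightarrow> 'b half_arc) \<Rightarrow> bool" where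
  "oriented_directed_embedding D \<rho> \<longleftrightarrow>
     \<rho> permutes half_arcs D \<and>
     (\<forall>v \<in> verts D. half_arcs_at D v \<noteq> {} \<longrightarrow> cyclic_on \<rho> (half_arcs_at D v)) \<and>
     (\<forall>h \<in> half_arcs D. is_Leaving (\<rho> h) \<longleftrightarrow> \<not> is_Leaving h)"

definition proface_next :: "('b half_arc \<Rightarrow> 'b half_arc) \<Rightarrow> 'b \<Rightarrow> 'b" where
  "proface_next \<rho> a = arc_of (inv \<rho> (Entering a))"

definition antiface_next :: "('b half_arc \<Rightarrow> 'b half_arc) \<Rightarrow> 'b \<Rightarrow> 'b" where
  "antiface_next \<rho> a = arc_of (\<rho> (Entering a))"

text \<open>
  \<^term>\<open>support f a\<close> is the list \<open>[a, f a, f (f a), \<dots>]\<close> up to the first return to \<open>a\<close>, that is,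
  the facial walk traced from \<open>a\<close>.
\<close>

definition profaces ::
    "('a, 'b) pre_digraph \<Rightarrow> ('b half_arc \<Rightarrow> 'b half_arc) \<Rightarrow> 'b list set set" where
  "profaces D \<rho> = (\<lambda>a. cyclic_class (support (proface_next \<rho>) a)) ` arcs D"

definition antifaces ::
    "('a, 'b) pre_digraph \<Rightarrow> ('b half_arc \<Rightarrow> 'b half_arc) \<Rightarrow> 'b list set set" where
  "antifaces D \<rho> = (\<lambda>a. cyclic_class (support (antiface_next \<rho>) a)) ` arcs D"

text \<open>
  The numbers of profaces and antifaces are added, rather than taking the cardinality of the
  union, since the same directed circuit can bound both a proface and an antiface (a directed
  cycle in the sphere). A digraph with one vertex and no arcs would have one face with an empty
  boundary walk, which is not counted here; the formula is meant for connected digraphs with at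
  least one arc.
\<close>

definition euler_characteristic ::
    "('a, 'b) pre_digraph \<Rightarrow> ('b half_arc \<Rightarrow> 'b half_arc) \<Rightarrow> int" where
  "euler_characteristic D \<rho> =
     int (card (verts D)) - int (card (arcs D))
     + int (card (profaces D \<rho>) + card (antifaces D \<rho>))"

text \<open>
  The genus \<open>g\<close> of an orientable surface with Euler characteristic \<open>\<chi>\<close> is determined by
  \<open>\<chi> = 2 - 2 g\<close>.
\<close>

definition genus :: "('a, 'b) pre_digraph \<Rightarrow> ('b half_arc \<Rightarrow> 'b half_arc) \<Rightarrow> real" where
  "genus D \<rho> = (2 - real_of_int (euler_characteristic D \<rho>)) / 2"

end

theory Submission
  imports Defs
begin

text \<open>
  Let \<open>\<pi>\<close> map each arc to the next one on its circuit of \<open>C\<close>. Choosing an embedding with profaces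
  \<open>C\<close> means choosing a permutation \<open>\<tau>\<close> of the arcs whose orbits are the sets of arcs entering each
  vertex, and then the antifaces are the orbits of \<open>\<pi> \<circ> \<tau>\<close>. Multiplying \<open>\<tau>\<close> by a suitable 3-cycle
  on arcs entering a vertex merges three antifaces there into one, or redistributes the stretches
  of two antifaces. Take \<open>\<tau>\<close> with the fewest antifaces and suppose there are at least three. Then
  every vertex meets at most two of them, and by connectedness some antiface \<open>M\<close> meets a vertex
  \<open>x\<close> shared with \<open>X\<close> and a vertex \<open>y\<close> shared with \<open>Y\<close>, for three distinct antifaces. Minimality
  forbids \<open>x\<close> and \<open>y\<close> to interlace on \<open>M\<close>, and forces a vertex lying on a stretch between visits to
  \<open>x\<close> without \<open>y\<close> and on a stretch between visits to \<open>y\<close> without \<open>x\<close> to lie on no other stretch.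
  As the graph is dense, many common neighbours of \<open>x\<close> and \<open>y\<close> are such vertices; but each stretch
  has only two ends, so they have too few neighbours among each other. Parity of permutations
  decides between one and two antifaces and bounds the genus of every competing embedding.
\<close>

section \<open>Orbits and transpositions\<close>

lemma orbit_eq_iff:
  assumes "permutation p"
  shows "y \<in> orbit p x \<longleftrightarrow> orbit p y = orbit p x"
  using cyclic_on_orbit'[OF assms, of x] permutation_self_in_orbit[OF assms]
  by (metis orbit_cyclic_eq3)

section \<open>The first element of a set met along an orbit\<close>

text \<open>\<open>hits p B e b\<close>: the first element of \<open>B\<close> among \<open>e, p e, p (p e), \<dots>\<close> is \<open>b\<close>.\<close>

inductive hits :: "('b \<Rightarrow> 'b) \<Rightarrow> 'b set \<Rightarrow> 'b \<Rightarrow> 'b \<Rightarrow> bool" for p B where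
  here: "b \<in> B \<Longrightarrow> hits p B b b"
| step: "e \<notin> B \<Longrightarrow> hits p B (p e) b \<Longrightarrow> hits p B e b"

lemma hits_mem: "hits p B e b \<Longrightarrow> b \<in> B"
  by (induction rule: hits.induct) auto

lemma hits_in: "e \<in> B \<Longrightarrow> hits p B e b \<Longrightarrow> b = e"
  by (erule hits.cases) auto

lemma hits_step_iff: "e \<notin> B \<Longrightarrow> hits p B e b \<longleftrightarrow> hits p B (p e) b"
  by (metis hits.simps)

lemma hits_unique: "hits p B e b \<Longrightarrow> hits p B e b' \<Longrightarrow> b = b'"
  by (induction rule: hits.induct) (auto dest: hits_in simp: hits_step_iff)

lemma hits_orbit:
  assumes "permutation p" "hits p B e b"
  shows "orbit p e = orbit p b"
  using assms(2)
  by (induction rule: hits.induct) (auto simp: permutation_orbit_step[OF assms(1)])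

lemma hits_ex:
  assumes "permutation p" "b \<in> B" "orbit p e = orbit p b"
  shows "\<exists>b'. hits p B e b'"
proof -
  have "b \<in> orbit p e"
    using assms permutation_self_in_orbit by metis
  then obtain n where "b = (p ^^ n) e"
    by (auto simp: orbit_altdef)
  then show ?thesis
  proof (induction n arbitrary: e)
    case 0
    then show ?case using assms(2) by (auto intro: hits.here)
  next
    case (Suc n)
    then show ?case
      by (metis hits.here hits.step funpow_simps_right(2) o_apply)
  qed
qed

text \<open>A walk up to its first element of \<open>B\<close> applies the map only outside
  \<open>B\<close>, so changes of the map on \<open>B\<close> are invisible to it. Modified
  rotations are compared through this fact.\<close>

lemma hits_cong:
  assumes "hits p B e b" "\<And>x. x \<notin> B \<Longrightarrow> q x = p x"
  shows "hits q B e b"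
  using assms(1) by (induction rule: hits.induct) (auto intro: hits.intros simp: assms(2) hits_step_iff)

text \<open>The walk from \<open>e\<close> meets one of \<open>i\<close> and \<open>b\<close> first,
  and from there it continues to the other.\<close>

lemma hits_order:
  assumes "hits p B e i" "hits p B' e b"
  shows "hits p B b i \<or> hits p B' i b"
  using assms
proof (induction rule: hits.induct)
  case (here i)
  then show ?case by auto
next
  case (step e i)
  then show ?case
    by (cases "e \<in> B'") (auto dest: hits_in intro: hits.step simp: hits_step_iff)
qed

text \<open>Both \<open>a\<close> and \<open>b\<close> are the first element of \<open>B\<close> met
  when walking backwards from \<open>i\<close>.\<close>

lemma hits_pred_unique:
  assumes p: "bij p" and ab: "a \<in> B" "b \<in> B" and "hits p B (p a) i" "hits p B (p b) i"
  shows "a = b"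
proof -
  \<comment> \<open>Generalised to a start \<open>e\<close> inside the stretch: no element of
    \<open>B\<close> lies between \<open>e\<close> and \<open>i\<close>, so retreating from
    \<open>i\<close> leads where retreating from \<open>e\<close> leads.\<close>
  have walk_back: "hits (inv p) B (inv p i) c"
    if "hits p B e i" "hits (inv p) B (inv p e) c" for e c
    using that
    by (induction rule: hits.induct) (auto intro: hits.intros simp: inv_f_f[OF bij_is_inj[OF p]])
  have "hits (inv p) B (inv p i) a" "hits (inv p) B (inv p i) b"
    by (rule walk_back[OF assms(4)] walk_back[OF assms(5)];
        simp add: inv_f_f[OF bij_is_inj[OF p]] hits.here ab)+
  then show ?thesis by (rule hits_unique)
qed

section \<open>Composing a permutation with a transposition\<close>

context
  fixes p :: "'b \<Rightarrow> 'b" and a b :: 'b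
  assumes p: "permutation p"
begin

private abbreviation "q \<equiv> p \<circ> transpose a b"

lemma permutation_comp_transpose: "permutation q"
  using p by (simp add: permutation_compose permutation_swap_id)

lemma orbit_comp_transpose_other:
  assumes "orbit p e \<noteq> orbit p a" "orbit p e \<noteq> orbit p b"
  shows "orbit q e = orbit p e"
proof (rule orbit_cong)
  show "e \<in> orbit p e" by (rule permutation_self_in_orbit[OF p])
  fix s assume "s \<in> orbit p e"
  then have "s \<noteq> a" "s \<noteq> b" using assms orbit_eq_iff[OF p] by auto
  then show "q s = p s" by simp
qed

lemma hits_comp_transpose:
  "hits p {a, b} e t \<Longrightarrow> hits q {a, b} e t"
  by (erule hits_cong) auto

text \<open>Up to its first visit to \<open>a\<close> or \<open>b\<close>, a walk of
  \<open>p\<close> is also a walk of the composite.\<close>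

lemma orbit_comp_transpose_subset:
  "orbit p a \<union> orbit p b \<subseteq> orbit q a \<union> orbit q b"
proof
  fix e assume "e \<in> orbit p a \<union> orbit p b"
  then obtain c where "c \<in> {a, b}" "orbit p e = orbit p c"
    using orbit_eq_iff[OF p] by blast
  then obtain t where "hits p {a, b} e t" using hits_ex[OF p] by blast
  then have "orbit q e = orbit q t" "t \<in> {a, b}"
    using hits_comp_transpose hits_orbit[OF permutation_comp_transpose] hits_mem by metis+
  then show "e \<in> orbit q a \<union> orbit q b"
    using permutation_self_in_orbit[OF permutation_comp_transpose] by blast
qed

end

context
  fixes p :: "'b \<Rightarrow> 'b" and a b :: 'b
  assumes p: "permutation p"
begin

private abbreviation "r \<equiv> p \<circ> transpose a b"

text \<open>Transposing twice restores \<open>p\<close>, so the inclusion above also holds with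
  \<open>p\<close> and the composite exchanged. A second context is opened to make this instance
  available.\<close>

lemma orbit_comp_transpose_Un:
  "orbit r a \<union> orbit r b = orbit p a \<union> orbit p b"
proof -
  have "r \<circ> transpose a b = p" by (simp add: comp_assoc)
  then show ?thesis
    using orbit_comp_transpose_subset[OF p, of a b]
      orbit_comp_transpose_subset[OF permutation_comp_transpose[OF p], of a b a b]
    by auto
qed

text \<open>The composite sends \<open>a\<close> to \<open>p b\<close>, and from there
  \<open>p\<close> runs back to \<open>b\<close> without meeting \<open>a\<close>, which is on
  another orbit. So \<open>a\<close> and \<open>b\<close> come to lie on one orbit.\<close>

lemma orbit_comp_transpose_merge:
  assumes "orbit p a \<noteq> orbit p b"
  shows "orbit r a = orbit p a \<union> orbit p b" "orbit r b = orbit p a \<union> orbit p b"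
proof -
  note r = permutation_comp_transpose[OF p, of a b]
  obtain t where t: "hits p {a, b} (p b) t"
    using hits_ex[OF p, of b "{a, b}" "p b"] permutation_orbit_step[OF p] by auto
  then have "orbit p t = orbit p b" "t \<in> {a, b}"
    using hits_orbit[OF p t] hits_mem[OF t] permutation_orbit_step[OF p] by auto
  then have "t = b" using assms by auto
  then have "orbit r (p b) = orbit r b"
    using hits_orbit[OF r hits_comp_transpose[OF p t]] by simp
  moreover have "orbit r a = orbit r (p b)"
    using permutation_orbit_step[OF r, of a] by simp
  ultimately show "orbit r a = orbit p a \<union> orbit p b" "orbit r b = orbit p a \<union> orbit p b"
    using orbit_comp_transpose_Un by auto
qed

lemma orbit_comp_transpose_split:
  assumes "a \<noteq> b" "orbit p a = orbit p b"
  shows "orbit r a \<noteq> orbit r b"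
proof
  assume eq: "orbit r a = orbit r b"
  note r = permutation_comp_transpose[OF p, of a b]
  \<comment> \<open>A walk that returns to \<open>u\<close> before meeting \<open>v\<close> repeats
    forever, so \<open>v\<close> is not on the orbit of \<open>u\<close>.\<close>
  have *: False if u: "hits g {a, b} (g u) u" and g: "orbit g a = orbit g b" "permutation g"
    and uv: "{u, v} = {a, b}" "u \<noteq> v" for g :: "'b \<Rightarrow> 'b" and u v
  proof -
    have "hits g {a, b} e u" if "e \<in> orbit g u" for e
      using that
    proof induction
      case (step e)
      then show ?case using u by (metis hits.cases)
    qed (rule u)
    moreover have "v \<in> orbit g u"
      using uv g orbit_eq_iff[of g] by (metis doubleton_eq_iff)
    ultimately have "hits g {a, b} v u" by blast
    then show False using uv hits_in[of v "{a, b}" g u] by auto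
  qed
  obtain t where t: "hits p {a, b} (p b) t"
    using hits_ex[OF p, of b "{a, b}" "p b"] permutation_orbit_step[OF p] by auto
  \<comment> \<open>If the walk from \<open>p b\<close> met \<open>b\<close> first, then
    \<open>a\<close> and \<open>b\<close> would be separated already under \<open>p\<close>.
    Otherwise it meets \<open>a\<close> first; as it is also the walk from \<open>r a\<close>, it
    separates them under \<open>r\<close>.\<close>
  show False
  proof (cases "t = b")
    case True
    then show False using *[of p b a] t assms p by auto
  next
    case False
    then have "hits r {a, b} (r a) a"
      using hits_mem[OF t] hits_comp_transpose[OF p t] by auto
    then show False using *[of r a b] eq assms r by auto
  qed
qed

end

section \<open>Numbers of orbits and their parity\<close>

definition orbit_count :: "'b set \<Rightarrow> ('b \<Rightarrow> 'b) \<Rightarrow> nat" where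
  "orbit_count A p = card (orbit p ` A)"

lemma orbit_count_aux:
  assumes "permutation p" "finite A" "a \<in> A" "b \<in> A"
  shows "orbit_count A p = card {orbit p e | e. e \<in> A \<and> orbit p e \<noteq> orbit p a \<and> orbit p e \<noteq> orbit p b}
           + card {orbit p a, orbit p b}"
proof -
  have "orbit p ` A = {orbit p e | e. e \<in> A \<and> orbit p e \<noteq> orbit p a \<and> orbit p e \<noteq> orbit p b}
     \<union> {orbit p a, orbit p b}"
    using assms by auto
  then show ?thesis unfolding orbit_count_def
    using assms by (simp only:) (subst card_Un_disjoint, auto)
qed

text \<open>All orbits avoiding \<open>a\<close> and \<open>b\<close> survive, so only the one or
  two orbits through these elements matter on either side. Both sides are sums to avoid
  subtraction.\<close>

lemma orbit_count_comp_transpose_aux: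
  assumes p: "permutation p" "finite A" "a \<in> A" "b \<in> A"
  shows "orbit_count A (p \<circ> transpose a b) + card {orbit p a, orbit p b}
    = orbit_count A p + card {orbit (p \<circ> transpose a b) a, orbit (p \<circ> transpose a b) b}"
proof -
  let ?q = "p \<circ> transpose a b"
  note q = permutation_comp_transpose[OF p(1), of a b]
  have iff: "orbit ?q e \<noteq> orbit ?q a \<and> orbit ?q e \<noteq> orbit ?q b \<longleftrightarrow>
      orbit p e \<noteq> orbit p a \<and> orbit p e \<noteq> orbit p b" for e
    using orbit_comp_transpose_Un[OF p(1), of a b] orbit_eq_iff[OF p(1)] orbit_eq_iff[OF q]
    by (metis Un_iff)
  have "{orbit ?q e | e. e \<in> A \<and> orbit ?q e \<noteq> orbit ?q a \<and> orbit ?q e \<noteq> orbit ?q b}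
      = {orbit p e | e. e \<in> A \<and> orbit p e \<noteq> orbit p a \<and> orbit p e \<noteq> orbit p b}"
    unfolding iff using orbit_comp_transpose_other[OF p(1), of _ a b] by (metis (no_types, lifting))
  then show ?thesis
    using orbit_count_aux[OF p] orbit_count_aux[OF q p(2-)] by simp
qed

lemma orbit_count_merge:
  assumes "permutation p" "finite A" "a \<in> A" "b \<in> A" "orbit p a \<noteq> orbit p b"
  shows "orbit_count A p = Suc (orbit_count A (p \<circ> transpose a b))"
  using orbit_count_comp_transpose_aux[OF assms(1-4)] orbit_comp_transpose_merge[OF assms(1,5)] assms(5)
  by simp

lemma orbit_count_split:
  assumes "permutation p" "finite A" "a \<in> A" "b \<in> A" "orbit p a = orbit p b" "a \<noteq> b"
  shows "orbit_count A (p \<circ> transpose a b) = Suc (orbit_count A p)"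
  using orbit_count_comp_transpose_aux[OF assms(1-4)] orbit_comp_transpose_split[OF assms(1,6,5)] assms(5)
  by simp

text \<open>Modulo 2, \<open>card A\<close> plus the number of orbits is the sign of a permutation,
  and sign is multiplicative. The induction builds \<open>r\<close> from transpositions, each of
  which changes the number of orbits by exactly one.\<close>

lemma orbit_count_comp_parity:
  assumes A: "finite A" and p: "p permutes A" and r: "r permutes A"
  shows "even (orbit_count A (p \<circ> r) + orbit_count A p + orbit_count A r + card A)"
  using A r
proof (induction rule: permutes_rev_induct)
  case id
  have *: "orbit id x = {x}" for x :: 'a by (simp add: orbit_eq_singleton_iff)
  then have "orbit_count A id = card A"
    unfolding orbit_count_def by (intro card_image inj_onI) (simp only: *, simp)
  then show ?case by (simp only: id_comp comp_id id_o o_id) simp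
next
  case (swap a b r)
  have "even (orbit_count A (s \<circ> transpose a b)) \<longleftrightarrow> odd (orbit_count A s)" if "s permutes A" for s
  proof -
    have "permutation s" using that A permutation_permutes by blast
    from orbit_count_merge[OF this A swap(1,2)] orbit_count_split[OF this A swap(1,2) _ swap(3)]
    show ?thesis by (cases "orbit s a = orbit s b") simp_all
  qed
  from this[OF swap(4)] this[OF permutes_compose[OF swap(4) p]] swap(5)
  show ?case unfolding comp_assoc even_add by argo
qed

section \<open>Systems of rotations with few faces\<close>

text \<open>Heads suffice here: an embedding is determined by the rotation of the entering
  half-arcs, because the half-arc leaving on \<open>\<pi> a\<close> has to stand immediately before
  the one entering on \<open>a\<close>.\<close>

locale rotation_system =
  fixes A :: "'b set" and h :: "'b \<Rightarrow> 'a" and \<pi> :: "'b \<Rightarrow> 'b"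
  assumes finA: "finite A" and \<pi>: "\<pi> permutes A"
begin

definition fibre :: "'a \<Rightarrow> 'b set" where
  "fibre v = {e \<in> A. h e = v}"

definition rot :: "('b \<Rightarrow> 'b) \<Rightarrow> bool" where
  "rot \<tau> \<longleftrightarrow> \<tau> permutes A \<and> (\<forall>a \<in> A. orbit \<tau> a = fibre (h a))"

abbreviation face :: "('b \<Rightarrow> 'b) \<Rightarrow> 'b \<Rightarrow> 'b set" where
  "face \<tau> \<equiv> orbit (\<pi> \<circ> \<tau>)"

abbreviation next_at :: "('b \<Rightarrow> 'b) \<Rightarrow> 'a \<Rightarrow> 'b \<Rightarrow> 'b \<Rightarrow> bool" where
  "next_at \<tau> v \<equiv> hits (\<pi> \<circ> \<tau>) (fibre v)"

definition rotmin :: "('b \<Rightarrow> 'b) \<Rightarrow> bool" where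
  "rotmin \<tau> \<longleftrightarrow> rot \<tau> \<and>
     (\<forall>\<tau>'. rot \<tau>' \<longrightarrow> orbit_count A (\<pi> \<circ> \<tau>) \<le> orbit_count A (\<pi> \<circ> \<tau>'))"

lemma fibre_iff: "a \<in> fibre v \<longleftrightarrow> a \<in> A \<and> h a = v"
  by (auto simp: fibre_def)

lemma permutes_permutation: "p permutes A \<Longrightarrow> permutation p"
  using finA permutation_permutes by blast

lemma rot_permutation: "rot \<tau> \<Longrightarrow> permutation \<tau>"
  by (simp add: rot_def permutes_permutation)

lemma rot_face_permutes: "rot \<tau> \<Longrightarrow> (\<pi> \<circ> \<tau>) permutes A"
  using \<pi> by (simp add: rot_def permutes_compose)

lemma rot_face_permutation: "rot \<tau> \<Longrightarrow> permutation (\<pi> \<circ> \<tau>)"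
  by (simp only: rot_face_permutes permutes_permutation)

lemma rot_apply:
  assumes "rot \<tau>" "a \<in> fibre v"
  shows "\<tau> a \<in> fibre v"
  using assms orbit.base[of \<tau> a] by (auto simp: rot_def fibre_iff)

lemma rot_fibre_eq:
  assumes "rot \<tau>" "a \<in> fibre v"
  shows "orbit \<tau> a = fibre v"
  using assms by (auto simp: rot_def fibre_iff)

section \<open>Changing a rotation at a single vertex\<close>

text \<open>
  Composing a full cycle with \<open>(a b)\<close> splits it into two cycles, and \<open>c\<close> lies apart from one of
  \<open>a\<close>, \<open>b\<close>; so one of the two ways of composing with a second transposition joins them again.
\<close>

lemma rot_resplit:
  assumes rot: "rot \<tau>" and abc: "a \<in> fibre v" "b \<in> fibre v" "c \<in> fibre v" and "a \<noteq> b"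
  obtains t where "t \<in> {a, b}" "rot (\<tau> \<circ> transpose a b \<circ> transpose t c)"
proof -
  note p = rot_permutation[OF rot]
  let ?\<sigma> = "\<tau> \<circ> transpose a b"
  note s = permutation_comp_transpose[OF p, of a b]
  have eq: "orbit \<tau> a = fibre v" "orbit \<tau> b = fibre v"
    using rot_fibre_eq[OF rot] abc by auto
  have ne: "orbit ?\<sigma> a \<noteq> orbit ?\<sigma> b"
    using orbit_comp_transpose_split[OF p \<open>a \<noteq> b\<close>] eq by simp
  have Un: "orbit ?\<sigma> a \<union> orbit ?\<sigma> b = fibre v"
    using orbit_comp_transpose_Un[OF p, of a b] eq by simp
  obtain t where t: "t \<in> {a, b}" "orbit ?\<sigma> t \<noteq> orbit ?\<sigma> c"
    using ne by (metis insertCI)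
  have "orbit ?\<sigma> c = orbit ?\<sigma> a \<or> orbit ?\<sigma> c = orbit ?\<sigma> b"
    using abc Un orbit_eq_iff[OF s] by blast
  then have Un': "orbit ?\<sigma> t \<union> orbit ?\<sigma> c = fibre v" using t Un by auto
  let ?r = "?\<sigma> \<circ> transpose t c"
  have "rot ?r"
    unfolding rot_def
  proof (intro conjI ballI)
    have "transpose a b permutes A" "transpose t c permutes A"
      using abc t by (auto intro!: permutes_swap_id simp: fibre_iff)
    then show "?r permutes A"
      using rot by (auto simp: rot_def intro!: permutes_compose)
    fix e assume "e \<in> A"
    show "orbit ?r e = fibre (h e)"
    proof (cases "h e = v")
      case True
      then have "e \<in> orbit ?\<sigma> t \<union> orbit ?\<sigma> c" using Un' \<open>e \<in> A\<close> by (simp add: fibre_iff)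
      then have "e \<in> orbit ?r t" using orbit_comp_transpose_merge[OF s t(2)] by simp
      then have "orbit ?r e = orbit ?r t"
        using orbit_eq_iff[OF permutation_comp_transpose[OF s]] by simp
      then show ?thesis using True Un' orbit_comp_transpose_merge[OF s t(2)] by simp
    next
      case False
      have e: "orbit \<tau> e = fibre (h e)" "e \<in> orbit \<tau> e"
        using rot \<open>e \<in> A\<close> by (auto simp: rot_def fibre_iff)
      then have "orbit \<tau> e \<noteq> fibre v" using False by (auto simp: fibre_iff)
      then have 1: "orbit ?\<sigma> e = orbit \<tau> e"
        using orbit_comp_transpose_other[OF p, of e a b] eq by simp
      have "e \<notin> orbit ?\<sigma> t \<union> orbit ?\<sigma> c" using Un' False by (simp add: fibre_iff)
      then have "orbit ?\<sigma> e \<noteq> orbit ?\<sigma> t" "orbit ?\<sigma> e \<noteq> orbit ?\<sigma> c"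
        using orbit_eq_iff[OF s] by auto
      then show ?thesis using orbit_comp_transpose_other[OF s, of e t c] 1 e by simp
    qed
  qed
  then show ?thesis using that t by blast
qed

text \<open>Among the permutations preserving heads, one with the fewest orbits will do: if the arcs
  entering a vertex formed several orbits, a transposition would merge two of them.\<close>

lemma rot_ex: "\<exists>\<tau>. rot \<tau>"
proof -
  define P where "P \<tau> \<longleftrightarrow> \<tau> permutes A \<and> (\<forall>a \<in> A. h (\<tau> a) = h a)" for \<tau>
  have "P id" by (simp add: P_def permutes_id)
  from ex_has_least_nat[of P, OF this, of "orbit_count A"]
  obtain \<tau> where \<tau>: "P \<tau>" "\<And>\<sigma>. P \<sigma> \<Longrightarrow> orbit_count A \<tau> \<le> orbit_count A \<sigma>" by blast
  have p: "permutation \<tau>" using \<tau>(1) by (simp add: P_def permutes_permutation)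
  have "orbit \<tau> a = fibre (h a)" if "a \<in> A" for a
  proof (intro equalityI subsetI)
    fix e assume "e \<in> orbit \<tau> a"
    then show "e \<in> fibre (h a)"
    proof induction
      case base
      then show ?case using \<tau>(1) \<open>a \<in> A\<close> by (simp add: P_def fibre_iff permutes_in_image)
    next
      case (step e)
      then show ?case using \<tau>(1) by (simp add: P_def fibre_iff permutes_in_image)
    qed
  next
    fix b assume b: "b \<in> fibre (h a)"
    show "b \<in> orbit \<tau> a"
    proof (rule ccontr)
      assume "b \<notin> orbit \<tau> a"
      then have "orbit \<tau> a \<noteq> orbit \<tau> b" using orbit_eq_iff[OF p] by blast
      from orbit_count_merge[OF p finA \<open>a \<in> A\<close> _ this] b
      have "orbit_count A (\<tau> \<circ> transpose a b) < orbit_count A \<tau>" by (simp add: fibre_iff)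
      moreover have "P (\<tau> \<circ> transpose a b)"
        using \<tau>(1) b \<open>a \<in> A\<close>
        by (auto simp: P_def fibre_iff transpose_def permutes_swap_id intro!: permutes_compose[of "transpose a b"])
      ultimately show False using \<tau>(2) by fastforce
    qed
  qed
  then show ?thesis using \<tau>(1) by (auto simp: rot_def P_def)
qed

lemma rotmin_ex: "\<exists>\<tau>. rotmin \<tau>"
proof -
  obtain \<tau> where "rot \<tau>" using rot_ex by blast
  from ex_has_least_nat[of rot, OF this, of "\<lambda>\<tau>. orbit_count A (\<pi> \<circ> \<tau>)"]
  show ?thesis by (auto simp: rotmin_def)
qed

text \<open>If the three faces were distinct, the first transposition of \<open>rot_resplit\<close>
  would merge the faces of \<open>a\<close> and \<open>b\<close> and the second would add that of
  \<open>c\<close>, leaving two faces fewer.\<close>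

lemma rotmin_two_faces:
  assumes "rotmin \<tau>" "a \<in> fibre v" "b \<in> fibre v" "c \<in> fibre v"
  shows "face \<tau> a = face \<tau> b \<or> face \<tau> b = face \<tau> c \<or> face \<tau> a = face \<tau> c"
proof (rule ccontr)
  assume "\<not> ?thesis"
  then have ne: "face \<tau> a \<noteq> face \<tau> b" "face \<tau> b \<noteq> face \<tau> c" "face \<tau> a \<noteq> face \<tau> c" by auto
  have rot: "rot \<tau>" using assms(1) by (simp add: rotmin_def)
  note p = rot_face_permutation[OF rot]
  have A: "a \<in> A" "b \<in> A" "c \<in> A" using assms by (auto simp: fibre_iff)
  have "a \<noteq> b" using ne by auto
  from rot_resplit[OF rot assms(2-4) this]
  obtain t where t: "t \<in> {a, b}" "rot (\<tau> \<circ> transpose a b \<circ> transpose t c)" .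
  let ?q = "\<pi> \<circ> \<tau> \<circ> transpose a b"
  note q = permutation_comp_transpose[OF p, of a b]
  have "orbit ?q c = face \<tau> c"
    using ne by (intro orbit_comp_transpose_other[OF p]) auto
  moreover have "orbit ?q t = face \<tau> a \<union> face \<tau> b"
    using orbit_comp_transpose_merge[OF p ne(1)] t(1) by auto
  moreover have "a \<in> face \<tau> a" "a \<notin> face \<tau> c"
    using ne orbit_eq_iff[OF p] by auto
  ultimately have "orbit ?q t \<noteq> orbit ?q c" by auto
  from orbit_count_merge[OF q finA _ A(3) this] orbit_count_merge[OF p finA A(1,2) ne(1)]
  have "orbit_count A (\<pi> \<circ> (\<tau> \<circ> transpose a b \<circ> transpose t c)) < orbit_count A (\<pi> \<circ> \<tau>)"
    using t A by (auto simp: comp_assoc)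
  then show False using t(2) assms(1) by (fastforce simp: rotmin_def)
qed

text \<open>If \<open>a\<close> and \<open>b\<close> share a face, the first transposition cuts it
  into a piece with \<open>a\<close> and a piece with \<open>b\<close>, and the second joins one
  piece to the face of \<open>c\<close>. The number of faces is unchanged, so minimality persists,
  and faces avoiding \<open>v\<close> are untouched.\<close>

lemma rotmin_separate:
  assumes min: "rotmin \<tau>" and abc: "a \<in> fibre v" "b \<in> fibre v" "c \<in> fibre v"
    and "a \<noteq> b" "face \<tau> a \<noteq> face \<tau> c"
  obtains \<tau>' where "rotmin \<tau>'" "face \<tau>' a \<noteq> face \<tau>' b" "\<And>e. e \<notin> fibre v \<Longrightarrow> \<tau>' e = \<tau> e"
    "\<And>e. face \<tau> e \<notin> face \<tau> ` fibre v \<Longrightarrow> face \<tau>' e = face \<tau> e"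
proof (cases "face \<tau> a = face \<tau> b")
  case False
  then show ?thesis using that min by blast
next
  case True
  have rot: "rot \<tau>" using min by (simp add: rotmin_def)
  note p = rot_face_permutation[OF rot]
  have A: "a \<in> A" "b \<in> A" "c \<in> A" using abc by (auto simp: fibre_iff)
  from rot_resplit[OF rot abc \<open>a \<noteq> b\<close>]
  obtain t where t: "t \<in> {a, b}" "rot (\<tau> \<circ> transpose a b \<circ> transpose t c)" .
  let ?q = "\<pi> \<circ> \<tau> \<circ> transpose a b"
  let ?\<tau>' = "\<tau> \<circ> transpose a b \<circ> transpose t c"
  have \<tau>': "\<pi> \<circ> ?\<tau>' = ?q \<circ> transpose t c" by (simp add: comp_assoc)
  note q = permutation_comp_transpose[OF p, of a b]
  note r = permutation_comp_transpose[OF q, of t c]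
  have ab: "orbit ?q a \<noteq> orbit ?q b"
    using orbit_comp_transpose_split[OF p \<open>a \<noteq> b\<close> True] .
  have c: "orbit ?q c = face \<tau> c"
    using assms True by (intro orbit_comp_transpose_other[OF p]) auto
  have Un: "orbit ?q a \<union> orbit ?q b = face \<tau> a"
    using orbit_comp_transpose_Un[OF p, of a b] True by simp
  have "t \<in> face \<tau> a" using t True permutation_self_in_orbit[OF p] by auto
  then have "t \<notin> face \<tau> c" using assms(6) orbit_eq_iff[OF p] by auto
  then have tc: "orbit ?q t \<noteq> orbit ?q c" using c permutation_self_in_orbit[OF q] by metis
  \<comment> \<open>The element of \<open>{a, b}\<close> other than \<open>t\<close>: its piece
    remains a face by itself, while that of \<open>t\<close> is joined to the face of
    \<open>c\<close>.\<close>
  obtain s where s: "s \<in> {a, b}" "{s, t} = {a, b}" "orbit ?q s \<noteq> orbit ?q t"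
    using ab t(1) by auto
  have "s \<in> face \<tau> a" using s True permutation_self_in_orbit[OF p] by auto
  then have "s \<notin> face \<tau> c" using assms(6) orbit_eq_iff[OF p] by auto
  then have sc: "orbit ?q s \<noteq> orbit ?q c" using c permutation_self_in_orbit[OF q] by metis
  have "face ?\<tau>' s = orbit ?q s"
    unfolding \<tau>' using s(3) sc by (rule orbit_comp_transpose_other[OF q])
  moreover have "face ?\<tau>' t = orbit ?q t \<union> orbit ?q c"
    unfolding \<tau>' by (rule orbit_comp_transpose_merge[OF q tc])
  moreover have "s \<notin> orbit ?q t \<union> orbit ?q c"
    using s(3) sc orbit_eq_iff[OF q] by blast
  moreover have "s \<in> orbit ?q s" by (rule permutation_self_in_orbit[OF q])
  ultimately have "face ?\<tau>' s \<noteq> face ?\<tau>' t" by metis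
  then have 2: "face ?\<tau>' a \<noteq> face ?\<tau>' b" using s(2) by (metis doubleton_eq_iff)
  have "t \<in> A" using t A by auto
  have "orbit_count A (\<pi> \<circ> ?\<tau>') = orbit_count A (\<pi> \<circ> \<tau>)"
    unfolding \<tau>' using orbit_count_merge[OF q finA \<open>t \<in> A\<close> A(3) tc]
      orbit_count_split[OF p finA A(1,2) True \<open>a \<noteq> b\<close>] by simp
  then have 1: "rotmin ?\<tau>'" using min t(2) by (simp add: rotmin_def)
  have 3: "?\<tau>' e = \<tau> e" if "e \<notin> fibre v" for e
    using that abc t(1) by (auto simp: transpose_def)
  have 4: "face ?\<tau>' e = face \<tau> e" if "face \<tau> e \<notin> face \<tau> ` fibre v" for e
  proof -
    have ne: "face \<tau> e \<noteq> face \<tau> a" "face \<tau> e \<noteq> face \<tau> b" "face \<tau> e \<noteq> face \<tau> c"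
      using that abc by auto
    then have e: "orbit ?q e = face \<tau> e"
      by (intro orbit_comp_transpose_other[OF p])
    have "orbit ?q e \<noteq> orbit ?q t"
      using e Un t(1) ne(1) orbit_eq_iff[OF p, of e a] permutation_self_in_orbit[OF q, of e] by auto
    moreover have "orbit ?q e \<noteq> orbit ?q c" using e c ne by simp
    ultimately show ?thesis
      unfolding \<tau>' using orbit_comp_transpose_other[OF q, of e t c] e by simp
  qed
  show ?thesis using that[OF 1 2 3 4] .
qed

text \<open>Otherwise a change at \<open>v\<close> puts \<open>b\<close> and \<open>b'\<close> on
  different faces. The walks from \<open>f\<close> and \<open>f'\<close> to them are unaffected and
  the face of \<open>d\<close> stays as it was, so \<open>w\<close> would meet three faces.\<close>

lemma rotmin_not_interlaced:
  assumes min: "rotmin \<tau>"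
    and v: "a \<in> fibre v" "a' \<in> fibre v" "face \<tau> a \<noteq> face \<tau> a'"
    and w: "f \<in> fibre w" "f' \<in> fibre w" "face \<tau> f = face \<tau> a" "face \<tau> f' = face \<tau> a"
    and d: "d \<in> fibre w" "face \<tau> d \<notin> face \<tau> ` fibre v"
    and b: "next_at \<tau> v f b" "next_at \<tau> v f' b'"
  shows "b = b'"
proof (rule ccontr)
  assume "b \<noteq> b'"
  have rot: "rot \<tau>" using min by (simp add: rotmin_def)
  note p = rot_face_permutation[OF rot]
  have b': "b \<in> fibre v" "b' \<in> fibre v" using hits_mem b by metis+
  have fb: "face \<tau> b = face \<tau> a" "face \<tau> b' = face \<tau> a"
    using b w hits_orbit[OF p] by metis+
  then have "face \<tau> b \<noteq> face \<tau> a'" using v by simp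
  with rotmin_separate[OF min b' v(2) \<open>b \<noteq> b'\<close>]
  obtain \<tau>' where \<tau>': "rotmin \<tau>'" "face \<tau>' b \<noteq> face \<tau>' b'" "\<And>e. e \<notin> fibre v \<Longrightarrow> \<tau>' e = \<tau> e"
    "\<And>e. face \<tau> e \<notin> face \<tau> ` fibre v \<Longrightarrow> face \<tau>' e = face \<tau> e" by blast
  have p': "permutation (\<pi> \<circ> \<tau>')" using \<tau>'(1) by (simp add: rotmin_def rot_face_permutation)
  have "next_at \<tau>' v f b" "next_at \<tau>' v f' b'"
    using hits_cong[OF b(1)] hits_cong[OF b(2)] \<tau>'(3) by auto
  then have f: "face \<tau>' f = face \<tau>' b" "face \<tau>' f' = face \<tau>' b'"
    using hits_orbit[OF p'] by auto
  have fd: "face \<tau>' d = face \<tau> d" using \<tau>'(4) d by blast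
  have "e \<notin> face \<tau> d" if "e \<in> fibre v" for e
    using that d(2) orbit_eq_iff[OF p, of e d] by (metis image_eqI)
  then have "face \<tau>' d \<noteq> face \<tau>' b" "face \<tau>' d \<noteq> face \<tau>' b'"
    using fd b' permutation_self_in_orbit[OF p'] by metis+
  then show False
    using rotmin_two_faces[OF \<tau>'(1) w(1,2) d(1)] f \<tau>'(2) by auto
qed

section \<open>Forks: two vertices on a common face, each with a private one\<close>

text \<open>
  A fork: the vertices \<open>x\<close> and \<open>y\<close> share a face \<open>M\<close>, and each of them meets a face that the other
  one does not meet. Between two consecutive visits to \<open>x\<close>, the face \<open>M\<close> meets \<open>y\<close> only before
  its visit \<open>P\<close> to \<open>x\<close>, and symmetrically with its visit \<open>Q\<close> to \<open>y\<close>.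
\<close>

definition fork :: "('b \<Rightarrow> 'b) \<Rightarrow> 'a \<Rightarrow> 'a \<Rightarrow> 'b \<Rightarrow> 'b \<Rightarrow> bool" where
  "fork \<tau> x y P Q \<longleftrightarrow> rotmin \<tau> \<and> x \<noteq> y \<and> P \<in> fibre x \<and> Q \<in> fibre y \<and> face \<tau> P = face \<tau> Q \<and>
     (\<exists>d \<in> fibre x. face \<tau> d \<notin> face \<tau> ` fibre y) \<and>
     (\<exists>d \<in> fibre y. face \<tau> d \<notin> face \<tau> ` fibre x) \<and>
     (\<forall>f \<in> fibre y. face \<tau> f = face \<tau> P \<longrightarrow> next_at \<tau> x f P) \<and>
     (\<forall>f \<in> fibre x. face \<tau> f = face \<tau> P \<longrightarrow> next_at \<tau> y f Q)"

lemma fork_sym: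
  assumes "fork \<tau> x y P Q"
  shows "fork \<tau> y x Q P"
proof -
  have "face \<tau> P = face \<tau> Q" using assms unfolding fork_def by (elim conjE)
  then show ?thesis
    using assms unfolding fork_def by (elim conjE) (intro conjI; (assumption | erule not_sym | simp only:))
qed

lemma fork_next:
  assumes "fork \<tau> x y P Q" "f \<in> fibre y" "face \<tau> f = face \<tau> P"
  shows "next_at \<tau> x f P"
  using assms unfolding fork_def by blast

lemma fork_outer: "fork \<tau> x y P Q \<Longrightarrow> \<exists>d \<in> fibre y. face \<tau> d \<notin> face \<tau> ` fibre x"
  unfolding fork_def by (elim conjE)

lemma fork_rotmin: "fork \<tau> x y P Q \<Longrightarrow> rotmin \<tau>"
  unfolding fork_def by (elim conjE)

lemma fork_mem: "fork \<tau> x y P Q \<Longrightarrow> P \<in> fibre x" "fork \<tau> x y P Q \<Longrightarrow> Q \<in> fibre y"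
  unfolding fork_def by (elim conjE, assumption)+

lemma fork_neq: "fork \<tau> x y P Q \<Longrightarrow> x \<noteq> y"
  unfolding fork_def by (elim conjE)

lemma fork_face_eq: "fork \<tau> x y P Q \<Longrightarrow> face \<tau> P = face \<tau> Q"
  unfolding fork_def by (elim conjE)

lemma fork_rot: "fork \<tau> x y P Q \<Longrightarrow> rot \<tau>"
  unfolding fork_def rotmin_def by (elim conjE)

text \<open>The vertex \<open>y\<close> meets at most two faces, namely the shared face
  \<open>M\<close> and one that avoids \<open>x\<close>.\<close>

lemma fork_common_face:
  assumes fork: "fork \<tau> x y P Q" and b: "b \<in> fibre y" "face \<tau> b \<in> face \<tau> ` fibre x"
  shows "face \<tau> b = face \<tau> P"
proof -
  obtain d where d: "d \<in> fibre y" "face \<tau> d \<notin> face \<tau> ` fibre x"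
    using fork_outer[OF fork] by blast
  have Q: "Q \<in> fibre y" "rotmin \<tau>" "face \<tau> P = face \<tau> Q" "P \<in> fibre x"
    using fork_mem[OF fork] fork_rotmin[OF fork] fork_face_eq[OF fork] by blast+
  have "face \<tau> d \<noteq> face \<tau> b" "face \<tau> d \<noteq> face \<tau> P" using d(2) b(2) Q(4) by (metis, metis imageI)
  then show ?thesis
    using rotmin_two_faces[OF Q(2) b(1) Q(1) d(1)] Q(3) by metis
qed

text \<open>The face of \<open>z\<close> meets both vertices, so it is \<open>M\<close>. If
  \<open>b\<close> is met first, the next visit to \<open>x\<close> is \<open>P\<close>; if
  \<open>i\<close> is met first, the next visit to \<open>y\<close> is \<open>Q\<close>.\<close>

lemma fork_exclusive:
  assumes fork: "fork \<tau> x y P Q" and z: "next_at \<tau> x z i" "next_at \<tau> y z b"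
  shows "i = P \<or> b = Q"
proof -
  note p = rot_face_permutation[OF fork_rot[OF fork]]
  have mem: "i \<in> fibre x" "b \<in> fibre y" using z hits_mem by metis+
  have eq: "face \<tau> b = face \<tau> i" using z hits_orbit[OF p] by metis
  have M: "face \<tau> b = face \<tau> P"
    by (rule fork_common_face[OF fork mem(2)]) (metis eq mem(1) imageI)
  have "next_at \<tau> x b P" by (rule fork_next[OF fork mem(2) M])
  moreover have "next_at \<tau> y i Q"
    using M eq fork_face_eq[OF fork] by (metis fork_next[OF fork_sym[OF fork] mem(1)])
  ultimately show ?thesis
    using hits_order[OF z] hits_unique[of _ "fibre x" b] hits_unique[of _ "fibre y" i] by blast
qed

text \<open>From a visit of \<open>M\<close> to \<open>x\<close> the next visit to \<open>y\<close>
  is \<open>Q\<close>, so the stretch leading to \<open>b\<close> contains no visit to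
  \<open>x\<close> and does not feel a change there.\<close>

lemma fork_next_at_cong:
  assumes fork: "fork \<tau> x y P Q" and \<tau>': "rot \<tau>'" "\<And>e. e \<notin> fibre x \<Longrightarrow> \<tau>' e = \<tau> e"
    and b: "face \<tau> b = face \<tau> P" "b \<noteq> Q"
  shows "next_at \<tau> y z b \<longleftrightarrow> next_at \<tau>' y z b"
proof
  note rot = fork_rot[OF fork]
  note p = rot_face_permutation[OF rot]
  have no: False if "e \<in> fibre x" "next_at \<tau> y e b" for e
  proof -
    have "next_at \<tau> y e Q"
      using hits_orbit[OF p that(2)] b(1) fork_face_eq[OF fork]
      by (metis fork_next[OF fork_sym[OF fork] that(1)])
    then show False using that(2) hits_unique[of _ "fibre y" e] b(2) by blast
  qed
  have xy: "e \<notin> fibre y" if "e \<in> fibre x" for e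
    using that fork by (auto simp: fibre_iff dest: fork_neq)
  have "next_at \<tau>' y z c" if "next_at \<tau> y z c" "c = b" for c
    using that
  proof (induction rule: hits.induct)
    case (here c)
    then show ?case by (auto intro: hits.here)
  next
    case (step e c)
    have "next_at \<tau> y e c" using step.hyps by (rule hits.step)
    then have "e \<notin> fibre x" using no step.prems by blast
    then have eq: "(\<pi> \<circ> \<tau>') e = (\<pi> \<circ> \<tau>) e" using \<tau>'(2) by simp
    have "next_at \<tau>' y ((\<pi> \<circ> \<tau>') e) c" using step.IH[OF step.prems] by (simp only: eq)
    then show ?case by (rule hits.step[OF step.hyps(1)])
  qed
  then show "next_at \<tau>' y z b" if "next_at \<tau> y z b" using that by blast
  have "next_at \<tau> y z c" if "next_at \<tau>' y z c" "c = b" for c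
    using that
  proof (induction rule: hits.induct)
    case (here c)
    then show ?case by (auto intro: hits.here)
  next
    case (step e c)
    \<comment> \<open>Both rotations permute the arcs entering \<open>x\<close>. So where the new
      face continues after \<open>e\<close>, the old one continues after some \<open>e'\<close>
      entering \<open>x\<close>, from which it would reach \<open>b\<close> instead of
      \<open>Q\<close>.\<close>
    have "e \<notin> fibre x"
    proof
      assume "e \<in> fibre x"
      then have "\<tau>' e \<in> orbit \<tau> e"
        using rot_apply[OF \<tau>'(1)] rot_fibre_eq[OF rot] by blast
      then obtain e' where e': "e' \<in> fibre x" "\<tau> e' = \<tau>' e"
        by (cases rule: orbit.cases) (use \<open>e \<in> fibre x\<close> rot_fibre_eq[OF rot] in auto)
      have "(\<pi> \<circ> \<tau>') e = (\<pi> \<circ> \<tau>) e'" using e'(2) by simp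
      then have "next_at \<tau> y ((\<pi> \<circ> \<tau>) e') c" using step.IH[OF step.prems] by (simp only:)
      then have "next_at \<tau> y e' c" by (rule hits.step[OF xy[OF e'(1)]])
      then show False using no[OF e'(1)] step.prems by simp
    qed
    then have eq: "(\<pi> \<circ> \<tau>') e = (\<pi> \<circ> \<tau>) e" using \<tau>'(2) by simp
    have "next_at \<tau> y ((\<pi> \<circ> \<tau>) e) c" using step.IH[OF step.prems] by (simp only: eq)
    then show ?case by (rule hits.step[OF step.hyps(1)])
  qed
  then show "next_at \<tau> y z b" if "next_at \<tau>' y z b" using that by blast
qed

text \<open>If \<open>g\<close> violated this, a change at \<open>x\<close> would separate the next
  visits of \<open>e\<close> and \<open>g\<close> to \<open>x\<close>. Either \<open>u\<close> then
  meets three faces, or \<open>f\<close> shares its new face with \<open>e\<close> or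
  \<open>g\<close> in a way that interlaces \<open>u\<close> with \<open>y\<close>.\<close>

lemma fork_visit_aux:
  assumes fork: "fork \<tau> x y P Q"
    and u: "e \<in> fibre u" "f \<in> fibre u" "g \<in> fibre u"
    and e: "next_at \<tau> x e i" "i \<noteq> P" and f: "next_at \<tau> y f b" "b \<noteq> Q"
  shows "next_at \<tau> x g i \<or> (\<exists>b'. b' \<noteq> Q \<and> next_at \<tau> y g b')"
proof (rule ccontr)
  assume contra: "\<not> ?thesis"
  then have gi: "\<not> next_at \<tau> x g i" and gb: "\<And>b'. next_at \<tau> y g b' \<Longrightarrow> b' = Q" by auto
  have eb: "\<And>b'. next_at \<tau> y e b' \<Longrightarrow> b' = Q"
    using fork_exclusive[OF fork e(1)] e(2) by blast
  have min: "rotmin \<tau>" by (rule fork_rotmin[OF fork])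
  note p = rot_face_permutation[OF fork_rot[OF fork]]
  have i: "i \<in> fibre x" "face \<tau> e = face \<tau> i" using hits_mem[OF e(1)] hits_orbit[OF p e(1)] by auto
  have b: "b \<in> fibre y" "face \<tau> f = face \<tau> b" using hits_mem[OF f(1)] hits_orbit[OF p f(1)] by auto
  have PQ: "P \<in> fibre x" "Q \<in> fibre y" "face \<tau> P = face \<tau> Q" 
    using fork_mem[OF fork] fork_face_eq[OF fork] by blast+
  obtain dy where dy: "dy \<in> fibre y" "face \<tau> dy \<notin> face \<tau> ` fibre x"
    using fork_outer[OF fork] by blast
  obtain dx where dx: "dx \<in> fibre x" "face \<tau> dx \<notin> face \<tau> ` fibre y"
    using fork_outer[OF fork_sym[OF fork]] by blast
  \<comment> \<open>The default \<open>P\<close> serves the case that the face of \<open>g\<close>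
    avoids \<open>x\<close>: there the change must separate \<open>i\<close> from \<open>P\<close>,
    since the face of \<open>f\<close> may follow \<open>P\<close>.\<close>
  define j where "j = (if \<exists>j. next_at \<tau> x g j then SOME j. next_at \<tau> x g j else P)"
  have j: "next_at \<tau> x g j" if "next_at \<tau> x g k" for k
    unfolding j_def using that by (auto intro: someI)
  have jP: "j = P" if "\<nexists>k. next_at \<tau> x g k"
    unfolding j_def using that by auto
  have jx: "j \<in> fibre x" using j jP PQ(1) hits_mem by metis
  have ij: "i \<noteq> j" using j jP gi e(2) by metis
  have "\<exists>c \<in> fibre x. face \<tau> i \<noteq> face \<tau> c"
    using dx PQ(1,2,3) by (metis image_eqI)
  then obtain c where c: "c \<in> fibre x" "face \<tau> i \<noteq> face \<tau> c" by blast
  obtain \<tau>' where \<tau>': "rotmin \<tau>'" "face \<tau>' i \<noteq> face \<tau>' j" "\<And>e. e \<notin> fibre x \<Longrightarrow> \<tau>' e = \<tau> e"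
    "\<And>e. face \<tau> e \<notin> face \<tau> ` fibre x \<Longrightarrow> face \<tau>' e = face \<tau> e"
    using rotmin_separate[OF min i(1) jx c(1) ij c(2)] by blast
  have rot': "rot \<tau>'" using \<tau>'(1) by (simp add: rotmin_def)
  note p' = rot_face_permutation[OF rot']
  have next': "next_at \<tau>' x z k" if "next_at \<tau> x z k" for z k
    using hits_cong[OF that] \<tau>'(3) by auto
  have face_x: "face \<tau>' z = face \<tau>' k" if "next_at \<tau> x z k" for z k
    using hits_orbit[OF p' next'[OF that]] .
  have away: "face \<tau>' z = face \<tau> z" "face \<tau>' z \<noteq> face \<tau>' k"
    if "face \<tau> z \<notin> face \<tau> ` fibre x" "k \<in> fibre x" for z k
  proof -
    show 1: "face \<tau>' z = face \<tau> z" using \<tau>'(4) that(1) by blast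
    have "k \<notin> face \<tau> z"
      using that orbit_eq_iff[OF p, of k z] by (metis image_eqI)
    then show "face \<tau>' z \<noteq> face \<tau>' k"
      unfolding 1 using permutation_self_in_orbit[OF p'] by metis
  qed
  have nexty: "next_at \<tau> y z b \<longleftrightarrow> next_at \<tau>' y z b" if "face \<tau> b = face \<tau> P" for z
    by (rule fork_next_at_cong[OF fork rot' \<tau>'(3) that f(2)])
  have two: "face \<tau>' e = face \<tau>' f \<or> face \<tau>' f = face \<tau>' g \<or> face \<tau>' e = face \<tau>' g"
    by (rule rotmin_two_faces[OF \<tau>'(1) u])
  have e': "face \<tau>' e = face \<tau>' i" by (rule face_x[OF e(1)])
  show False
  proof (cases "\<exists>k. next_at \<tau> x g k")
    case False
    then have "\<And>k. k \<in> fibre x \<Longrightarrow> face \<tau> g \<noteq> face \<tau> k" using hits_ex[OF p] by metis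
    then have g: "face \<tau> g \<notin> face \<tau> ` fibre x" by auto
    have g': "face \<tau>' g \<noteq> face \<tau>' i" using away[OF g] i by blast
    \<comment> \<open>Here \<open>g\<close> keeps a face avoiding \<open>x\<close>, while
      \<open>e\<close> follows \<open>i\<close>. If \<open>b\<close> is on \<open>M\<close>, then
      \<open>f\<close> follows \<open>P\<close>; if not, the face of \<open>f\<close> is untouched
      too. Either way \<open>u\<close> meets three faces.\<close>
    show False
    proof (cases "face \<tau> b = face \<tau> P")
      case True
      then have "next_at \<tau> x b P" by (rule fork_next[OF fork b(1)])
      then have "face \<tau>' b = face \<tau>' P" by (rule face_x)
      moreover have "face \<tau>' f = face \<tau>' b"
        using nexty[OF True] f(1) hits_orbit[OF p'] by metis
      ultimately have "face \<tau>' f = face \<tau>' P" by simp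
      then show False
        using two e' g' away(2)[OF g PQ(1)] \<tau>'(2) jP[OF False] by metis
    next
      case F: False
      then have "face \<tau> f \<notin> face \<tau> ` fibre x" using fork_common_face[OF fork b(1)] b(2) by metis
      note f' = away[OF this]
      \<comment> \<open>On a common face \<open>g\<close> would have a next visit to
        \<open>y\<close>, which can only be \<open>Q\<close>; then the face is \<open>M\<close>,
        which meets \<open>x\<close>.\<close>
      have "face \<tau> g \<noteq> face \<tau> f"
      proof
        assume "face \<tau> g = face \<tau> f"
        then obtain k where k: "next_at \<tau> y g k" using hits_ex[OF p b(1)] b(2) by metis
        then have "k = Q" by (rule gb)
        then have "face \<tau> g = face \<tau> P" using hits_orbit[OF p k] PQ by simp
        then show False using g PQ(1) by blast
      qed
      then have "face \<tau>' g \<noteq> face \<tau>' f" using f'(1)[OF PQ(1)] away(1)[OF g PQ(1)] by simp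
      then show False using two e' g' f'(2)[OF i(1)] by metis
    qed
  next
    case True
    then have gj: "next_at \<tau> x g j" using j by blast
    have g': "face \<tau>' g = face \<tau>' j" by (rule face_x[OF gj])
    \<comment> \<open>Otherwise the face of \<open>f\<close> avoids \<open>x\<close>, and
      \<open>e\<close>, \<open>f\<close>, \<open>g\<close> would lie on three faces after the
      change.\<close>
    have M: "face \<tau> b = face \<tau> P"
    proof (rule ccontr)
      assume F: "face \<tau> b \<noteq> face \<tau> P"
      then have "face \<tau> f \<notin> face \<tau> ` fibre x" using fork_common_face[OF fork b(1)] b(2) by metis
      from away(2)[OF this] show False using two e' g' \<tau>'(2) i(1) jx by metis
    qed
    have fb: "next_at \<tau>' y f b" "face \<tau>' f = face \<tau>' b"
      using nexty[OF M] f(1) hits_orbit[OF p'] by metis+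
    have bP: "face \<tau>' b = face \<tau>' P"
      by (rule face_x[OF fork_next[OF fork b(1) M]])
    have dy': "face \<tau>' b \<noteq> face \<tau>' dy" using away(2)[OF dy(2) PQ(1)] bP by metis
    \<comment> \<open>Here \<open>r\<close> is the one of \<open>e\<close>, \<open>g\<close> that
      shares the new face of \<open>f\<close>, and \<open>s\<close> is the other. Since
      \<open>y\<close> meets the faces of \<open>b\<close> and \<open>dy\<close>, that of
      \<open>s\<close> avoids \<open>y\<close>. So \<open>u\<close> and \<open>y\<close> do not
      interlace, and \<open>r\<close> has next visit \<open>b\<close> to \<open>y\<close>, although
      \<open>Q\<close> is its only option.\<close>
    have main: False if r: "r \<in> fibre u" "s \<in> fibre u" "face \<tau>' r = face \<tau>' b" "face \<tau>' s \<noteq> face \<tau>' b"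
      "face \<tau>' s = face \<tau>' k" "k \<in> fibre x" "\<And>b'. next_at \<tau> y r b' \<Longrightarrow> b' = Q" for r s k
    proof -
      have s: "face \<tau>' s \<notin> face \<tau>' ` fibre y"
      proof
        assume "face \<tau>' s \<in> face \<tau>' ` fibre y"
        then obtain q where q: "q \<in> fibre y" "face \<tau>' s = face \<tau>' q" by blast
        show False
          using rotmin_two_faces[OF \<tau>'(1) b(1) q(1) dy(1)] q(2) r(4,5) dy' away(2)[OF dy(2) r(6)]
          by metis
      qed
      obtain b' where b': "next_at \<tau>' y r b'" using hits_ex[OF p' b(1) r(3)] by blast
      have "b = b'"
        by (rule rotmin_not_interlaced[OF \<tau>'(1) b(1) dy(1) dy' u(2) r(1) fb(2) r(3) r(2) s fb(1) b'])
      then have "next_at \<tau> y r b" using nexty[OF M] b' by simp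
      then show False using r(7) f(2) by blast
    qed
    show False
    proof (cases "face \<tau>' f = face \<tau>' e")
      case True
      show False
        by (rule main[OF u(1,3) _ _ g' jx eb]) (use True fb e' g' \<tau>'(2) in auto)
    next
      case False
      then have "face \<tau>' f = face \<tau>' g" using two e' g' \<tau>'(2) by metis
      then show False
        by (intro main[OF u(3,1) _ _ e' i(1) gb]) (use fb e' g' \<tau>'(2) in auto)
    qed
  qed
qed

text \<open>If both alternatives failed, the two symmetric uses of \<open>fork_visit_aux\<close>
  would give \<open>g\<close> a next visit to \<open>x\<close> other than \<open>P\<close> and one
  to \<open>y\<close> other than \<open>Q\<close>, against \<open>fork_exclusive\<close>.\<close>

lemma fork_visit:
  assumes fork: "fork \<tau> x y P Q"
    and u: "e \<in> fibre u" "f \<in> fibre u" "g \<in> fibre u"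
    and e: "next_at \<tau> x e i" "i \<noteq> P" and f: "next_at \<tau> y f b" "b \<noteq> Q"
  shows "next_at \<tau> x g i \<or> next_at \<tau> y g b"
  using fork_visit_aux[OF fork u e f] fork_visit_aux[OF fork_sym[OF fork] u(2,1,3) f e]
    fork_exclusive[OF fork] by blast

end

section \<open>Stretches of faces in a dense digraph\<close>

locale dense_rotation_system = rotation_system A h \<pi>
  for A :: "'b set" and h :: "'b \<Rightarrow> 'a" and \<pi> :: "'b \<Rightarrow> 'b" +
  fixes t :: "'b \<Rightarrow> 'a" and V :: "'a set" and k :: nat
  assumes t_\<pi>: "a \<in> A \<Longrightarrow> t (\<pi> a) = h a"
    and finV: "finite V" and h_V: "a \<in> A \<Longrightarrow> h a \<in> V"
    and conn: "\<lbrakk>W \<subseteq> V; W \<noteq> {}; \<And>g. g \<in> A \<Longrightarrow> t g \<in> W \<longleftrightarrow> h g \<in> W\<rbrakk> \<Longrightarrow> W = V"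
    and nonadj: "v \<in> V \<Longrightarrow> card {u \<in> V. u \<noteq> v \<and>
      \<not> (\<exists>g \<in> A. t g = u \<and> h g = v \<or> t g = v \<and> h g = u)} \<le> k"
    and card_V: "5 * k + 7 \<le> card V"
begin

definition adj :: "'a \<Rightarrow> 'a \<Rightarrow> bool" where
  "adj u v \<longleftrightarrow> (\<exists>g \<in> A. t g = u \<and> h g = v \<or> t g = v \<and> h g = u)"

lemma t_face:
  assumes "rot \<tau>" "a \<in> A"
  shows "t ((\<pi> \<circ> \<tau>) a) = h a"
proof -
  have "\<tau> a \<in> fibre (h a)" by (rule rot_apply[OF assms(1)]) (simp add: fibre_iff assms(2))
  then show ?thesis using t_\<pi> by (simp add: fibre_iff)
qed

lemma face_pred:
  assumes "rot \<tau>" "g \<in> A"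
  obtains e where "e \<in> fibre (t g)" "(\<pi> \<circ> \<tau>) e = g"
proof -
  note perm = rot_face_permutes[OF assms(1)]
  obtain e where "(\<pi> \<circ> \<tau>) e = g" using permutes_surj[OF perm] by (metis surjD)
  moreover then have "e \<in> A" using permutes_in_image[OF perm, of e] assms(2) by simp
  ultimately show ?thesis using that[of e] t_face[OF assms(1), of e] by (auto simp: fibre_iff)
qed

text \<open>The neighbours of \<open>x\<close> on the stretch between the visits to \<open>x\<close> preceding and ending at \<open>i\<close>.\<close>

definition ends :: "('b \<Rightarrow> 'b) \<Rightarrow> 'a \<Rightarrow> 'b \<Rightarrow> 'a set" where
  "ends \<tau> x i = insert (t i) {h ((\<pi> \<circ> \<tau>) a) | a. a \<in> fibre x \<and> next_at \<tau> x ((\<pi> \<circ> \<tau>) a) i}"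

text \<open>The visit \<open>i\<close> that closes a stretch determines the visit that opens it, by
  \<open>hits_pred_unique\<close>.\<close>

lemma ends_card:
  assumes "rot \<tau>"
  shows "finite (ends \<tau> x i)" "card (ends \<tau> x i) \<le> 2"
proof -
  have bij: "bij (\<pi> \<circ> \<tau>)" using permutes_bij[OF rot_face_permutes[OF assms]] .
  let ?S = "{h ((\<pi> \<circ> \<tau>) a) | a. a \<in> fibre x \<and> next_at \<tau> x ((\<pi> \<circ> \<tau>) a) i}"
  have "\<exists>u. ?S \<subseteq> {u}"
  proof (cases "?S = {}")
    case False
    then obtain a where a: "a \<in> fibre x" "next_at \<tau> x ((\<pi> \<circ> \<tau>) a) i" by blast
    have "b = a" if "b \<in> fibre x" "next_at \<tau> x ((\<pi> \<circ> \<tau>) b) i" for b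
      by (rule hits_pred_unique[OF bij that(1) a(1) that(2) a(2)])
    then have "?S \<subseteq> {h ((\<pi> \<circ> \<tau>) a)}" by blast
    then show ?thesis ..
  qed blast
  then obtain u where "?S \<subseteq> {u}" ..
  then have sub: "ends \<tau> x i \<subseteq> {t i, u}" unfolding ends_def by blast
  then show "finite (ends \<tau> x i)" by (rule finite_subset) simp
  have "card (ends \<tau> x i) \<le> card {t i, u}" using sub by (intro card_mono) simp
  also have "\<dots> \<le> 2" by (simp add: card_insert_if)
  finally show "card (ends \<tau> x i) \<le> 2" .
qed

text \<open>An arc into \<open>x\<close> closes a stretch, and an arc out of \<open>x\<close> is the
  first arc of one.\<close>

lemma ends_adj:
  assumes "rot \<tau>" "adj u x"
  obtains i where "i \<in> fibre x" "u \<in> ends \<tau> x i"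
proof -
  obtain g where g: "g \<in> A" "t g = u \<and> h g = x \<or> t g = x \<and> h g = u"
    using assms(2) by (auto simp: adj_def)
  show ?thesis
  proof (cases "t g = u \<and> h g = x")
    case True
    then show ?thesis using that[of g] g(1) by (simp add: ends_def fibre_iff)
  next
    case False
    then have g': "t g = x" "h g = u" using g(2) by auto
    obtain a where a: "a \<in> fibre x" "(\<pi> \<circ> \<tau>) a = g"
      using face_pred[OF assms(1) g(1)] g'(1) by metis
    note p = rot_face_permutation[OF assms(1)]
    have "face \<tau> g = face \<tau> a" using permutation_orbit_step[OF p, of a] a(2) by metis
    then obtain i where i: "next_at \<tau> x g i" using hits_ex[OF p a(1)] by blast
    then have "u \<in> ends \<tau> x i" unfolding ends_def using a g' by blast
    then show ?thesis using that hits_mem[OF i] by blast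
  qed
qed

text \<open>The visit is made by the arc preceding \<open>i\<close> on its face or by the first arc
  of the stretch. As \<open>u\<close> differs from \<open>x\<close>, the preceding arc still has
  \<open>i\<close> as its next visit to \<open>x\<close>.\<close>

lemma ends_visit:
  assumes "rot \<tau>" "i \<in> fibre x" "u \<in> ends \<tau> x i" "u \<noteq> x"
  obtains e where "e \<in> fibre u" "next_at \<tau> x e i"
proof (cases "u = t i")
  case True
  have "i \<in> A" using assms(2) by (simp add: fibre_iff)
  obtain e where e: "e \<in> fibre u" "(\<pi> \<circ> \<tau>) e = i"
    using face_pred[OF assms(1) \<open>i \<in> A\<close>] True by metis
  have "e \<notin> fibre x" using e(1) assms(4) by (simp add: fibre_iff)
  moreover have "next_at \<tau> x ((\<pi> \<circ> \<tau>) e) i" unfolding e(2) using assms(2) by (rule hits.here)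
  ultimately show ?thesis using that[OF e(1)] hits.step by metis
next
  case False
  then obtain a where a: "a \<in> fibre x" "next_at \<tau> x ((\<pi> \<circ> \<tau>) a) i" "u = h ((\<pi> \<circ> \<tau>) a)"
    using assms(3) unfolding ends_def by blast
  have "a \<in> A" using a(1) by (simp add: fibre_iff)
  then have "(\<pi> \<circ> \<tau>) a \<in> A" using permutes_in_image[OF rot_face_permutes[OF assms(1)]] by metis
  then show ?thesis using that[OF _ a(2)] a(3) by (simp only: fibre_iff)
qed

text \<open>The stretch ending at \<open>P\<close> is excluded because in a fork it is the only one
  on which the other vertex \<open>y\<close> can occur.\<close>

definition row :: "('b \<Rightarrow> 'b) \<Rightarrow> 'a \<Rightarrow> 'b \<Rightarrow> 'a set" where
  "row \<tau> x P = {u \<in> V. \<exists>i \<in> fibre x. i \<noteq> P \<and> u \<in> ends \<tau> x i}"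

text \<open>Every neighbour of \<open>x\<close> is an end of some stretch, so only non-neighbours
  and the two ends of the excluded stretch can be missing.\<close>

lemma row_card:
  assumes "rot \<tau>" "x \<in> V"
  shows "card (V - {x} - row \<tau> x P) \<le> k + 2"
proof -
  let ?N = "{u \<in> V. u \<noteq> x \<and> \<not> adj u x}"
  have "V - {x} - row \<tau> x P \<subseteq> ?N \<union> ends \<tau> x P"
  proof
    fix u assume u: "u \<in> V - {x} - row \<tau> x P"
    show "u \<in> ?N \<union> ends \<tau> x P"
    proof (cases "adj u x")
      case True
      then obtain i where "i \<in> fibre x" "u \<in> ends \<tau> x i" using ends_adj[OF assms(1)] by blast
      then show ?thesis using u by (cases "i = P") (auto simp: row_def)
    qed (use u in blast)
  qed
  then have "card (V - {x} - row \<tau> x P) \<le> card (?N \<union> ends \<tau> x P)"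
    using ends_card[OF assms(1)] finV by (intro card_mono) auto
  also have "\<dots> \<le> card ?N + card (ends \<tau> x P)" by (rule card_Un_le)
  also have "\<dots> \<le> k + 2"
    using nonadj[OF assms(2)] ends_card(2)[OF assms(1)] unfolding adj_def by (intro add_mono)
  finally show ?thesis .
qed

lemma fork_not_row:
  assumes fork: "fork \<tau> x y P Q"
  shows "y \<notin> row \<tau> x P"
proof
  assume "y \<in> row \<tau> x P"
  then obtain i where i: "i \<in> fibre x" "i \<noteq> P" "y \<in> ends \<tau> x i" by (auto simp: row_def)
  obtain e where e: "e \<in> fibre y" "next_at \<tau> x e i"
    using ends_visit[OF fork_rot[OF fork] i(1,3)] fork_neq[OF fork] by metis
  have "face \<tau> e = face \<tau> i" using hits_orbit[OF rot_face_permutation[OF fork_rot[OF fork]] e(2)] .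
  then have "face \<tau> e = face \<tau> P" using fork_common_face[OF fork e(1)] i(1) by (metis imageI)
  then have "next_at \<tau> x e P" by (rule fork_next[OF fork e(1)])
  then show False using hits_unique[OF e(2)] i(2) by blast
qed

text \<open>
  A vertex of \<open>row \<tau> x P \<inter> row \<tau> y Q\<close> is visited only on one stretch between visits to \<open>x\<close> and
  one between visits to \<open>y\<close>. It can only be adjacent to the vertices of this set that share
  one of its two stretches, and a stretch has only two ends.
\<close>

lemma no_fork: "\<not> fork \<tau> x y P Q"
proof
  assume fork: "fork \<tau> x y P Q"
  note rot = fork_rot[OF fork]
  note fork' = fork_sym[OF fork]
  note p = rot_face_permutation[OF rot]
  have V: "x \<in> V" "y \<in> V" using fork_mem[OF fork] h_V by (auto simp: fibre_iff)
  define U where "U = row \<tau> x P \<inter> row \<tau> y Q - {x, y}"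
  have uV: "v \<in> V" if "v \<in> U" for v using that by (auto simp: U_def row_def)
  have finU: "finite U" using finV uV by (meson finite_subset subsetI)
  \<comment> \<open>Removing \<open>x\<close> and \<open>y\<close> from \<open>U\<close> costs
    nothing extra: by \<open>fork_not_row\<close>, each of them is already missing from the row of
    the other.\<close>
  have "V - U \<subseteq> (V - {x} - row \<tau> x P) \<union> (V - {y} - row \<tau> y Q)"
    using fork_not_row[OF fork] fork_not_row[OF fork'] fork_neq[OF fork] unfolding U_def by blast
  then have "card (V - U) \<le> card ((V - {x} - row \<tau> x P) \<union> (V - {y} - row \<tau> y Q))"
    using finV by (intro card_mono) auto
  also have "\<dots> \<le> card (V - {x} - row \<tau> x P) + card (V - {y} - row \<tau> y Q)"
    by (rule card_Un_le)
  also have "\<dots> \<le> 2 * k + 4"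
    using row_card[OF rot V(1), of P] row_card[OF rot V(2), of Q] by simp
  finally have "card (V - U) \<le> 2 * k + 4" .
  moreover have "card V = card (V - U) + card U"
    using card_Diff_subset[OF finU, of V] card_mono[OF finV, of U] uV by (simp add: subsetI)
  ultimately have U: "3 * k + 3 \<le> card U" using card_V by simp
  have "\<exists>i. i \<in> fibre x \<and> i \<noteq> P \<and> u \<in> ends \<tau> x i" if "u \<in> U" for u
    using that unfolding U_def row_def by blast
  then obtain r where r: "\<And>u. u \<in> U \<Longrightarrow> r u \<in> fibre x \<and> r u \<noteq> P \<and> u \<in> ends \<tau> x (r u)"
    by metis
  have "\<exists>i. i \<in> fibre y \<and> i \<noteq> Q \<and> u \<in> ends \<tau> y i" if "u \<in> U" for u
    using that unfolding U_def row_def by blast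
  then obtain c where c: "\<And>u. u \<in> U \<Longrightarrow> c u \<in> fibre y \<and> c u \<noteq> Q \<and> u \<in> ends \<tau> y (c u)"
    by metis
  have visit: "next_at \<tau> x g (r u) \<or> next_at \<tau> y g (c u)" if u: "u \<in> U" "g \<in> fibre u" for u g
  proof -
    obtain e where e: "e \<in> fibre u" "next_at \<tau> x e (r u)"
      using ends_visit[OF rot, of "r u" x u] r[OF u(1)] u(1) unfolding U_def by blast
    obtain f where f: "f \<in> fibre u" "next_at \<tau> y f (c u)"
      using ends_visit[OF rot, of "c u" y u] c[OF u(1)] u(1) unfolding U_def by blast
    show ?thesis
      by (rule fork_visit[OF fork e(1) f(1) u(2) e(2) _ f(2)]) (use r[OF u(1)] c[OF u(1)] in simp_all)
  qed
  \<comment> \<open>Since \<open>g\<close> and its predecessor \<open>e\<close> on the face have the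
    same next visits to \<open>x\<close> and \<open>y\<close>, \<open>g\<close> lies on one of the
    two stretches of its tail and on one of those of its head. By \<open>fork_exclusive\<close>
    these are both at \<open>x\<close> or both at \<open>y\<close>, hence equal.\<close>
  have arc: "r (t g) = r (h g) \<or> c (t g) = c (h g)" if g: "g \<in> A" "t g \<in> U" "h g \<in> U" for g
  proof -
    obtain e where e: "e \<in> fibre (t g)" "(\<pi> \<circ> \<tau>) e = g" using face_pred[OF rot g(1)] by blast
    have ne: "e \<notin> fibre x" "e \<notin> fibre y" using e(1) g(2) by (auto simp: fibre_iff U_def)
    have 1: "next_at \<tau> x g (r (t g)) \<or> next_at \<tau> y g (c (t g))"
      using visit[OF g(2) e(1)]
      unfolding hits_step_iff[OF ne(1), of "\<pi> \<circ> \<tau>"] hits_step_iff[OF ne(2), of "\<pi> \<circ> \<tau>"] e(2) .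
    have 2: "next_at \<tau> x g (r (h g)) \<or> next_at \<tau> y g (c (h g))"
      using visit[OF g(3)] g(1) by (simp add: fibre_iff)
    have no: False if "next_at \<tau> x g (r u)" "next_at \<tau> y g (c v)" "u \<in> U" "v \<in> U" for u v
      using fork_exclusive[OF fork that(1,2)] r[OF that(3)] c[OF that(4)] by blast
    show ?thesis
      using 1 2 no[OF _ _ g(2,3)] no[OF _ _ g(3,2)]
        hits_unique[of "\<pi> \<circ> \<tau>" "fibre x" g "r (t g)" "r (h g)"]
        hits_unique[of "\<pi> \<circ> \<tau>" "fibre y" g "c (t g)" "c (h g)"] by argo
  qed
  have adj: "r u = r v \<or> c u = c v" if uv: "adj u v" "u \<in> U" "v \<in> U" for u v
  proof -
    obtain g where "g \<in> A" "t g = u \<and> h g = v \<or> t g = v \<and> h g = u"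
      using uv(1) unfolding adj_def by blast
    then show ?thesis using arc[of g] uv(2,3) by auto
  qed
  have r2: "card {u \<in> U. r u = i} \<le> 2" for i
  proof -
    have "{u \<in> U. r u = i} \<subseteq> ends \<tau> x i" using r by blast
    then show ?thesis using ends_card[OF rot, of x i] card_mono le_trans by blast
  qed
  have c2: "card {u \<in> U. c u = i} \<le> 2" for i
  proof -
    have "{u \<in> U. c u = i} \<subseteq> ends \<tau> y i" using c by blast
    then show ?thesis using ends_card[OF rot, of y i] card_mono le_trans by blast
  qed
  have "card U > 0" using U by simp
  then obtain u where u: "u \<in> U" by (metis card_gt_0_iff ex_in_conv)
  let ?N = "{v \<in> V. v \<noteq> u \<and> \<not> adj v u}"
  let ?R = "{v \<in> U. r v = r u}" and ?C = "{v \<in> U. c v = c u}"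
  have N: "card ?N \<le> k" using nonadj[OF uV[OF u]] unfolding adj_def .
  have "card (?R - {u}) \<le> 1" "card (?C - {u}) \<le> 1"
    using r2[of "r u"] c2[of "c u"] u finU by (simp_all add: card_Diff_singleton)
  moreover have "card (U - {u}) \<le> card ?N + card (?R - {u}) + card (?C - {u})"
  proof -
    have "U - {u} \<subseteq> ?N \<union> (?R - {u}) \<union> (?C - {u})"
      using adj[OF _ _ u] uV by blast
    then have "card (U - {u}) \<le> card (?N \<union> (?R - {u}) \<union> (?C - {u}))"
      using finU finV by (intro card_mono) simp_all
    also have "\<dots> \<le> card (?N \<union> (?R - {u})) + card (?C - {u})" by (rule card_Un_le)
    also have "\<dots> \<le> card ?N + card (?R - {u}) + card (?C - {u})"
      by (intro add_right_mono card_Un_le)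
    finally show ?thesis .
  qed
  \<comment> \<open>The four parts of \<open>U\<close> are \<open>u\<close>, its at most
    \<open>k\<close> non-neighbours, and at most one partner on each of its two stretches.\<close>
  ultimately have "card U \<le> k + 3" using N u finU by (simp add: card_Diff_singleton)
  with U have k: "k = 0" and U3: "card U = 3" by auto
  have adj0: "adj v w" if "v \<in> U" "w \<in> U" "v \<noteq> w" for v w
  proof -
    have "card {u \<in> V. u \<noteq> w \<and> \<not> adj u w} = 0"
      using nonadj[OF uV[OF that(2)]] k unfolding adj_def by simp
    then have "{u \<in> V. u \<noteq> w \<and> \<not> adj u w} = {}" using finV by simp
    then show ?thesis using that uV by blast
  qed
  obtain a b d where abd: "U = {a, b, d}" "a \<noteq> b" "b \<noteq> d" "a \<noteq> d"
    using U3 by (auto simp: card_3_iff)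
  then have mem: "a \<in> U" "b \<in> U" "d \<in> U" by blast+
  have "r a = r b \<or> c a = c b" "r b = r d \<or> c b = c d" "r a = r d \<or> c a = c d"
    using adj[OF adj0] mem abd(2-4) by blast+
  \<comment> \<open>Three pairs and two kinds of stretch: two pairs share the same kind, so all
    three vertices are ends of one stretch.\<close>
  then have "r a = r b \<and> r b = r d \<or> c a = c b \<and> c b = c d" by metis
  then have "{u \<in> U. r u = r a} = {a, b, d} \<or> {u \<in> U. c u = c a} = {a, b, d}"
    unfolding abd(1) by auto
  then have "card {a, b, d} \<le> 2" using r2[of "r a"] c2[of "c a"] by auto
  then show False using abd(2-4) by simp
qed

text \<open>The visits \<open>P\<close> and \<open>Q\<close> are found by following \<open>M\<close>
  from \<open>a'\<close> to \<open>h a\<close> and from \<open>a\<close> to \<open>h a'\<close>.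
  That every other start leads to the same visits is \<open>rotmin_not_interlaced\<close>, as each
  vertex has a face avoiding the other.\<close>

lemma fork_exI:
  assumes min: "rotmin \<tau>" and A: "a \<in> A" "b \<in> A" "a' \<in> A" "c \<in> A"
    and h: "h a = h b" "h a' = h c" and M: "face \<tau> a = face \<tau> a'"
    and ne: "face \<tau> b \<noteq> face \<tau> a" "face \<tau> c \<noteq> face \<tau> a" "face \<tau> b \<noteq> face \<tau> c"
  shows "\<exists>P Q. fork \<tau> (h a) (h a') P Q"
proof -
  let ?x = "h a" and ?y = "h a'"
  have rot: "rot \<tau>" using min by (simp add: rotmin_def)
  note p = rot_face_permutation[OF rot]
  have mem: "a \<in> fibre ?x" "b \<in> fibre ?x" "a' \<in> fibre ?y" "c \<in> fibre ?y"
    using A h by (auto simp: fibre_iff)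
  have c: "face \<tau> c \<notin> face \<tau> ` fibre ?x"
    using rotmin_two_faces[OF min mem(1,2)] ne by fastforce
  have b: "face \<tau> b \<notin> face \<tau> ` fibre ?y"
    using rotmin_two_faces[OF min mem(3,4)] ne M by fastforce
  have xy: "?x \<noteq> ?y" using c mem(4) by auto
  obtain P where P: "next_at \<tau> ?x a' P" using hits_ex[OF p mem(1) M[symmetric]] by blast
  obtain Q where Q: "next_at \<tau> ?y a Q" using hits_ex[OF p mem(3) M] by blast
  have PM: "face \<tau> P = face \<tau> a" using hits_orbit[OF p P] M by simp
  have QM: "face \<tau> Q = face \<tau> a" using hits_orbit[OF p Q] by simp
  have 1: "next_at \<tau> ?x f P" if "f \<in> fibre ?y" "face \<tau> f = face \<tau> P" for f
  proof -
    have f: "face \<tau> f = face \<tau> a" using that(2) PM by simp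
    then obtain P' where P': "next_at \<tau> ?x f P'" using hits_ex[OF p mem(1)] by blast
    have "P' = P"
      by (rule rotmin_not_interlaced[OF min mem(1,2) ne(1)[symmetric] that(1) mem(3) f M[symmetric] mem(4) c P' P])
    then show ?thesis using P' by simp
  qed
  have 2: "next_at \<tau> ?y f Q" if "f \<in> fibre ?x" "face \<tau> f = face \<tau> P" for f
  proof -
    have f: "face \<tau> f = face \<tau> a'" using that(2) PM M by simp
    then obtain Q' where Q': "next_at \<tau> ?y f Q'" using hits_ex[OF p mem(3)] by blast
    have "face \<tau> a' \<noteq> face \<tau> c" using ne M by simp
    then have "Q' = Q"
      by (rule rotmin_not_interlaced[OF min mem(3,4) _ that(1) mem(1) f M mem(2) b Q' Q])
    then show ?thesis using Q' by simp
  qed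
  have "face \<tau> P = face \<tau> Q" using PM QM by simp
  moreover have "P \<in> fibre ?x" "Q \<in> fibre ?y" using P Q hits_mem by metis+
  moreover have "\<exists>d \<in> fibre ?x. face \<tau> d \<notin> face \<tau> ` fibre ?y" using mem(2) b by blast
  moreover have "\<exists>d \<in> fibre ?y. face \<tau> d \<notin> face \<tau> ` fibre ?x" using mem(4) c by blast
  ultimately have "fork \<tau> ?x ?y P Q"
    unfolding fork_def using min xy by (intro conjI ballI impI 1 2)
  then show ?thesis by blast
qed

text \<open>If \<open>S\<close> shared no vertex with the remaining arcs, the heads of
  \<open>S\<close> would form a vertex set that no arc leaves or enters. By connectedness this is
  all of \<open>V\<close>, so no arc could remain outside \<open>S\<close>.\<close>

lemma faces_connected:
  assumes rot: "rot \<tau>" and S: "S \<subseteq> A" "S \<noteq> {}" "S \<noteq> A" "\<And>a. (\<pi> \<circ> \<tau>) a \<in> S \<longleftrightarrow> a \<in> S"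
  shows "\<exists>a b. a \<in> S \<and> b \<in> A \<and> b \<notin> S \<and> h a = h b"
proof (rule ccontr)
  assume no: "\<not> ?thesis"
  have sep: "b \<in> S" if "a \<in> S" "b \<in> A" "h a = h b" for a b
    using no that by blast
  have "h ` S = V"
  proof (rule conn)
    show "h ` S \<subseteq> V" using S(1) h_V by blast
    show "h ` S \<noteq> {}" using S(2) by blast
    fix g assume g: "g \<in> A"
    obtain e where e: "e \<in> fibre (t g)" "(\<pi> \<circ> \<tau>) e = g" using face_pred[OF rot g] by blast
    have eA: "e \<in> A" "h e = t g" using e(1) by (auto simp: fibre_iff)
    have "t g \<in> h ` S \<longleftrightarrow> e \<in> S" using sep[OF _ eA(1)] eA(2) by (metis imageE imageI)
    moreover have "e \<in> S \<longleftrightarrow> g \<in> S" using S(4)[of e] e(2) by simp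
    moreover have "g \<in> S \<longleftrightarrow> h g \<in> h ` S" using sep[OF _ g] by (metis imageE imageI)
    ultimately show "t g \<in> h ` S \<longleftrightarrow> h g \<in> h ` S" by blast
  qed
  have "b \<in> S" if "b \<in> A" for b
  proof -
    obtain a where "a \<in> S" "h a = h b" using h_V[OF \<open>b \<in> A\<close>] \<open>h ` S = V\<close> by (metis imageE)
    then show ?thesis using sep that by blast
  qed
  then have "A \<subseteq> S" by blast
  then show False using S(1,3) by blast
qed

theorem rotmin_at_most_two_faces:
  assumes min: "rotmin \<tau>"
  shows "orbit_count A (\<pi> \<circ> \<tau>) \<le> 2"
proof (rule ccontr)
  assume "\<not> ?thesis"
  then have many: "2 < card (face \<tau> ` A)" by (simp add: orbit_count_def)
  have rot: "rot \<tau>" using min by (simp add: rotmin_def)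
  note p = rot_face_permutation[OF rot]
  have sub: "face \<tau> a \<subseteq> A" if "a \<in> A" for a
    using permutes_orbit_subset[OF rot_face_permutes[OF rot] that] .
  have closed: "(\<pi> \<circ> \<tau>) e \<in> face \<tau> a \<longleftrightarrow> e \<in> face \<tau> a" for a e
    using orbit_eq_iff[OF p] permutation_orbit_step[OF p, of e] by simp
  have cover: "face \<tau> a \<union> face \<tau> b \<noteq> A" if "a \<in> A" "b \<in> A" for a b
  proof
    assume eq: "face \<tau> a \<union> face \<tau> b = A"
    have "face \<tau> ` A \<subseteq> {face \<tau> a, face \<tau> b}"
    proof
      fix f assume "f \<in> face \<tau> ` A"
      then obtain e where "e \<in> A" "f = face \<tau> e" by blast
      then show "f \<in> {face \<tau> a, face \<tau> b}" using eq orbit_eq_iff[OF p] by blast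
    qed
    then have "card (face \<tau> ` A) \<le> card {face \<tau> a, face \<tau> b}" by (intro card_mono) auto
    also have "\<dots> \<le> 2" by (simp add: card_insert_if)
    finally show False using many by simp
  qed
  have "A \<noteq> {}" using many by auto
  then obtain a0 where a0: "a0 \<in> A" by blast
  \<comment> \<open>Connectedness is used twice: to find two faces meeting at a vertex, and then a
    third one meeting their union.\<close>
  have "face \<tau> a0 \<noteq> A" using cover[OF a0 a0] by simp
  from faces_connected[OF rot sub[OF a0] orbit_nonempty this closed]
  obtain a b where ab: "a \<in> face \<tau> a0" "b \<in> A" "b \<notin> face \<tau> a0" "h a = h b" by blast
  have aA: "a \<in> A" using ab(1) sub[OF a0] by blast
  have ab_ne: "face \<tau> b \<noteq> face \<tau> a" using ab(1,3) orbit_eq_iff[OF p] by metis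
  have ne: "face \<tau> a \<union> face \<tau> b \<noteq> {}" using orbit_nonempty[of "\<pi> \<circ> \<tau>" a] by blast
  have sub2: "face \<tau> a \<union> face \<tau> b \<subseteq> A" using sub aA ab(2) by blast
  obtain a' c where ac: "a' \<in> face \<tau> a \<union> face \<tau> b" "c \<in> A" "c \<notin> face \<tau> a \<union> face \<tau> b" "h a' = h c"
    using faces_connected[OF rot sub2 ne cover[OF aA ab(2)]] unfolding Un_iff closed by blast
  have a'A: "a' \<in> A" using ac(1) sub2 by blast
  have c_ne: "face \<tau> c \<noteq> face \<tau> a" "face \<tau> c \<noteq> face \<tau> b"
    using ac(3) orbit_eq_iff[OF p, of c] by auto
  \<comment> \<open>The face containing \<open>a'\<close> meets both of the others, so it plays the
    role of \<open>M\<close>.\<close>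
  consider "face \<tau> a' = face \<tau> a" | "face \<tau> a' = face \<tau> b"
    using ac(1) orbit_eq_iff[OF p, of a'] by blast
  then show False
  proof cases
    case 1
    have "\<exists>P Q. fork \<tau> (h a) (h a') P Q"
      by (rule fork_exI[OF min aA ab(2) a'A ac(2) ab(4) ac(4) 1[symmetric]]) (use ab_ne c_ne in auto)
    then show False using no_fork by blast
  next
    case 2
    have "\<exists>P Q. fork \<tau> (h b) (h a') P Q"
      by (rule fork_exI[OF min ab(2) aA a'A ac(2) ab(4)[symmetric] ac(4) 2[symmetric]])
        (use ab_ne c_ne in auto)
    then show False using no_fork by blast
  qed
qed

end

section \<open>Facial walks as orbits\<close>

lemma circuit_arcs_cyclic_class [simp]: "circuit_arcs (cyclic_class xs) = set xs"
  by (auto simp: circuit_arcs_def cyclic_class_def)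

lemma cyclic_class_rotate [simp]: "cyclic_class (rotate n xs) = cyclic_class xs"
proof -
  have sub: "cyclic_class (rotate n ys) \<subseteq> cyclic_class ys" for n and ys :: "'b list"
    by (auto simp: cyclic_class_def rotate_rotate)
  define m where "m = length xs - n mod length xs"
  have "rotate m (rotate n xs) = xs"
  proof (cases "xs = []")
    case False
    then have "(m + n) mod length xs = 0"
      using mod_less_divisor[of "length xs" n]
      by (metis m_def le_add_diff_inverse2 length_greater_0_conv less_imp_le mod_add_right_eq mod_self)
    then show ?thesis by (simp add: rotate_rotate rotate_id)
  qed simp
  then have "cyclic_class xs \<subseteq> cyclic_class (rotate n xs)" using sub[of m "rotate n xs"] by simp
  then show ?thesis using sub by blast
qed

lemma set_support:
  assumes "permutation p"
  shows "set (support p a) = orbit p a"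
  unfolding support_set[OF assms] orbit_altdef_permutation[OF assms] by blast

lemma least_power_eq_card_orbit:
  assumes "permutation p"
  shows "least_power p a = card (orbit p a)"
  using distinct_card[OF cycle_of_permutation[OF assms, of a]] set_support[OF assms, of a] by simp

text \<open>On one orbit \<open>p\<close> acts as the cyclic shift of the list
  \<open>support p a\<close>, so starting \<open>n\<close> steps later rotates that list.\<close>

lemma support_funpow:
  assumes "permutation p"
  shows "support p ((p ^^ n) a) = rotate n (support p a)"
proof -
  define xs where "xs = support p a"
  have set: "set xs = orbit p a" unfolding xs_def by (rule set_support[OF assms])
  have cyc: "p b = cycle_of_list xs b" if "b \<in> set xs" for b
    using cycle_restrict[OF assms, of b a] that unfolding xs_def by simp
  have eq: "(p ^^ m) b = (cycle_of_list xs ^^ m) b" if "b \<in> set xs" for b m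
  proof (induction m)
    case (Suc m)
    have "(p ^^ m) b \<in> set xs"
      using that unfolding set by (rule funpow_in_orbit)
    then show ?case using Suc cyc by simp
  qed simp
  have "(p ^^ n) a \<in> orbit p a"
    by (intro funpow_in_orbit permutation_self_in_orbit assms)
  then have lp: "least_power p ((p ^^ n) a) = least_power p a"
    unfolding least_power_eq_card_orbit[OF assms] using orbit_eq_iff[OF assms] by metis
  have "distinct xs" unfolding xs_def by (rule cycle_of_permutation[OF assms])
  then have "rotate n xs = map (cycle_of_list xs ^^ n) xs" by (rule cyclic_rotation[symmetric])
  also have "\<dots> = map (p ^^ n) xs"
    by (intro map_cong refl) (rule eq[symmetric])
  also have "\<dots> = support p ((p ^^ n) a)"
  proof -
    have "(p ^^ n) ((p ^^ i) a) = (p ^^ i) ((p ^^ n) a)" for i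
      by (metis add.commute funpow_add o_apply)
    then show ?thesis unfolding lp xs_def map_map comp_def by (intro map_cong refl)
  qed
  finally show ?thesis unfolding xs_def by (rule sym)
qed

lemma cyclic_class_support_eq_iff:
  assumes p: "permutation p"
  shows "cyclic_class (support p a) = cyclic_class (support p b) \<longleftrightarrow> orbit p a = orbit p b"
proof
  assume "cyclic_class (support p a) = cyclic_class (support p b)"
  then show "orbit p a = orbit p b"
    using circuit_arcs_cyclic_class set_support[OF p] by metis
next
  assume "orbit p a = orbit p b"
  then have "b \<in> orbit p a" using permutation_self_in_orbit[OF p] by simp
  then obtain n where "b = (p ^^ n) a" by (auto simp: orbit_altdef)
  then show "cyclic_class (support p a) = cyclic_class (support p b)"
    using support_funpow[OF p] by (metis cyclic_class_rotate)
qed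

lemma card_faces:
  assumes p: "permutation p"
  shows "card ((\<lambda>a. cyclic_class (support p a)) ` A) = orbit_count A p"
proof -
  define f where "f a = cyclic_class (support p a)" for a
  have arcs: "circuit_arcs (f a) = orbit p a" for a
    unfolding f_def circuit_arcs_cyclic_class by (rule set_support[OF p])
  have "inj_on circuit_arcs (f ` A)"
  proof (rule inj_onI)
    fix c d assume "c \<in> f ` A" "d \<in> f ` A" and eq: "circuit_arcs c = circuit_arcs d"
    then obtain a b where ab: "c = f a" "d = f b" by (elim imageE)
    then have "orbit p a = orbit p b" using eq by (simp only: arcs)
    then show "c = d" unfolding ab f_def cyclic_class_support_eq_iff[OF p] .
  qed
  then have "card (circuit_arcs ` f ` A) = card (f ` A)" by (rule card_image)
  moreover have "circuit_arcs ` f ` A = orbit p ` A" by (simp only: image_image arcs)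
  ultimately show ?thesis unfolding orbit_count_def f_def by simp
qed

text \<open>Iterating \<open>p\<close> from the head of \<open>q\<close> reads off the entries of
  \<open>q\<close> in order, so the walk traced from there is \<open>q\<close> itself; any other
  start only rotates it.\<close>

lemma cyclic_class_support_eq:
  assumes p: "permutation p" and q: "distinct q" "map p q = rotate1 q" and a: "a \<in> set q"
  shows "cyclic_class (support p a) = cyclic_class q"
proof -
  have ne: "q \<noteq> []" using a by auto
  have rot: "map (p ^^ n) q = rotate n q" for n
  proof (induction n)
    case (Suc n)
    have "map (p ^^ Suc n) q = map p (map (p ^^ n) q)" by simp
    also have "\<dots> = map p (rotate n q)" by (simp only: Suc)
    also have "\<dots> = rotate n (rotate1 q)" by (simp only: rotate_map[symmetric] q(2))
    finally show ?case by (simp only: rotate_Suc rotate1_rotate_swap)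
  qed simp
  have nth: "(p ^^ n) (hd q) = q ! (n mod length q)" for n
    using arg_cong[OF rot[of n], of hd] ne by (simp add: hd_map hd_rotate_conv_nth)
  have "orbit p (hd q) = set q"
  proof (intro equalityI subsetI)
    fix b assume "b \<in> orbit p (hd q)"
    then obtain n where "b = (p ^^ n) (hd q)" by (auto simp: orbit_altdef)
    then show "b \<in> set q" using nth ne by simp
  next
    fix b assume "b \<in> set q"
    then obtain n where "n < length q" "b = q ! n" by (auto simp: in_set_conv_nth)
    then have "b = (p ^^ n) (hd q)" using nth by simp
    then show "b \<in> orbit p (hd q)" unfolding orbit_altdef_permutation[OF p] by blast
  qed
  moreover from this have "least_power p (hd q) = length q"
    using least_power_eq_card_orbit[OF p] distinct_card[OF q(1)] by simp
  then have "support p (hd q) = map (\<lambda>i. q ! i) [0..<length q]"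
    unfolding \<open>least_power p (hd q) = length q\<close> using nth by (intro map_cong) auto
  then have "support p (hd q) = q" by (simp only: map_nth)
  ultimately show ?thesis
    using cyclic_class_support_eq_iff[OF p, of a "hd q"] orbit_eq_iff[OF p, of a "hd q"] a by metis
qed

section \<open>Permutations of an oriented directed embedding\<close>

locale embedded_digraph = fin_digraph D for D :: "('a, 'b) pre_digraph" +
  fixes \<sigma> :: "'b half_arc \<Rightarrow> 'b half_arc"
  assumes emb: "oriented_directed_embedding D \<sigma>"
begin

text \<open>Directions alternate, so two clockwise steps from an entering half-arc reach the next
  entering one. This is the \<open>\<tau>\<close> belonging to a given embedding.\<close>

definition arc_rot :: "'b \<Rightarrow> 'b" where
  "arc_rot a = arc_of (\<sigma> (\<sigma> (Entering a)))"

lemma \<sigma>_permutes: "\<sigma> permutes half_arcs D"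
  using emb by (simp add: oriented_directed_embedding_def)

lemma \<sigma>_Entering:
  assumes "a \<in> arcs D"
  shows "\<sigma> (Entering a) = Leaving (antiface_next \<sigma> a)" "antiface_next \<sigma> a \<in> arcs D"
proof -
  have "Entering a \<in> half_arcs D" using assms by (simp add: half_arcs_def)
  then have "is_Leaving (\<sigma> (Entering a))" "\<sigma> (Entering a) \<in> half_arcs D"
    using emb permutes_in_image[OF \<sigma>_permutes] by (auto simp: oriented_directed_embedding_def)
  then show "\<sigma> (Entering a) = Leaving (antiface_next \<sigma> a)" "antiface_next \<sigma> a \<in> arcs D"
    by (auto simp: antiface_next_def half_arcs_def)
qed

lemma \<sigma>_Leaving:
  assumes "a \<in> arcs D"
  obtains b where "\<sigma> (Leaving a) = Entering b" "b \<in> arcs D"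
proof -
  have "Leaving a \<in> half_arcs D" using assms by (simp add: half_arcs_def)
  then have "\<not> is_Leaving (\<sigma> (Leaving a))" "\<sigma> (Leaving a) \<in> half_arcs D"
    using emb permutes_in_image[OF \<sigma>_permutes] by (auto simp: oriented_directed_embedding_def)
  then show ?thesis using that by (auto simp: half_arcs_def)
qed

lemma \<sigma>_\<sigma>_Entering:
  assumes "a \<in> arcs D"
  shows "\<sigma> (\<sigma> (Entering a)) = Entering (arc_rot a)" "arc_rot a \<in> arcs D"
proof -
  obtain b where b: "\<sigma> (Leaving (antiface_next \<sigma> a)) = Entering b" "b \<in> arcs D"
    using \<sigma>_Leaving[OF \<sigma>_Entering(2)[OF assms]] .
  then show "\<sigma> (\<sigma> (Entering a)) = Entering (arc_rot a)" "arc_rot a \<in> arcs D"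
    using \<sigma>_Entering(1)[OF assms] by (simp_all add: arc_rot_def)
qed

lemma outside:
  assumes "a \<notin> arcs D"
  shows "arc_rot a = a" "antiface_next \<sigma> a = a" "proface_next \<sigma> a = a"
proof -
  have "Entering a \<notin> half_arcs D" using assms by (auto simp: half_arcs_def)
  then have "\<sigma> (Entering a) = Entering a" "inv \<sigma> (Entering a) = Entering a"
    using permutes_not_in[OF \<sigma>_permutes] permutes_not_in[OF permutes_inv[OF \<sigma>_permutes]] by auto
  then show "arc_rot a = a" "antiface_next \<sigma> a = a" "proface_next \<sigma> a = a"
    by (simp_all add: arc_rot_def antiface_next_def proface_next_def)
qed

lemma \<sigma>_inj: "\<sigma> h = \<sigma> h' \<Longrightarrow> h = h'"
  using permutes_inj[OF \<sigma>_permutes] by (rule injD)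

lemma permutes_arcsI:
  fixes f :: "'b \<Rightarrow> 'b"
  assumes "\<And>a. a \<in> arcs D \<Longrightarrow> f a \<in> arcs D" "inj_on f (arcs D)" "\<And>a. a \<notin> arcs D \<Longrightarrow> f a = a"
  shows "f permutes arcs D"
proof (rule bij_imp_permutes)
  have "f ` arcs D = arcs D"
    using assms(1,2) by (intro endo_inj_surj) auto
  then show "bij_betw f (arcs D) (arcs D)" using assms(2) by (simp add: bij_betw_def)
qed (rule assms(3))

lemma antiface_next_permutes: "antiface_next \<sigma> permutes arcs D"
proof (rule permutes_arcsI)
  show "inj_on (antiface_next \<sigma>) (arcs D)"
    using \<sigma>_Entering(1) \<sigma>_inj by (intro inj_onI) (metis half_arc.inject(2))
qed (use \<sigma>_Entering(2) outside in auto)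

lemma arc_rot_permutes: "arc_rot permutes arcs D"
proof (rule permutes_arcsI)
  show "inj_on arc_rot (arcs D)"
    using \<sigma>_\<sigma>_Entering(1) \<sigma>_inj by (intro inj_onI) (metis half_arc.inject(2))
qed (use \<sigma>_\<sigma>_Entering(2) outside in auto)

text \<open>The half-arc between the entering half-arcs of \<open>a\<close> and
  \<open>arc_rot a\<close> follows the former and precedes the latter.\<close>

lemma antiface_next_eq: "antiface_next \<sigma> = proface_next \<sigma> \<circ> arc_rot"
proof
  fix a
  show "antiface_next \<sigma> a = (proface_next \<sigma> \<circ> arc_rot) a"
  proof (cases "a \<in> arcs D")
    case True
    have "inv \<sigma> (Entering (arc_rot a)) = \<sigma> (Entering a)"
      unfolding \<sigma>_\<sigma>_Entering(1)[OF True, symmetric] by (rule permutes_inverses(2)[OF \<sigma>_permutes])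
    then show ?thesis by (simp add: proface_next_def antiface_next_def)
  qed (simp add: outside)
qed

lemma proface_next_permutes: "proface_next \<sigma> permutes arcs D"
proof -
  have "antiface_next \<sigma> \<circ> inv arc_rot = proface_next \<sigma>"
    unfolding antiface_next_eq by (simp add: comp_assoc permutes_inv_o[OF arc_rot_permutes])
  then show ?thesis
    using permutes_compose[OF permutes_inv[OF arc_rot_permutes] antiface_next_permutes] by simp
qed

lemma orbit_arc_rot:
  assumes "a \<in> arcs D"
  shows "orbit arc_rot a = {e \<in> arcs D. head D e = head D a}"
proof -
  let ?H = "half_arcs_at D (head D a)"
  have a: "Entering a \<in> ?H" using assms by (simp add: half_arcs_at_def half_arcs_def)
  have "cyclic_on \<sigma> ?H"
    using emb assms a by (auto simp: oriented_directed_embedding_def)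
  then have H: "orbit \<sigma> (Entering a) = ?H" using a by (rule orbit_cyclic_eq3)
  have p: "permutation arc_rot"
    using arc_rot_permutes finite_arcs permutation_permutes by blast
  have sub: "e \<in> arcs D" if "e \<in> orbit arc_rot a" for e
    using that permutes_orbit_subset[OF arc_rot_permutes assms] by blast
  \<comment> \<open>Tracing the whole cycle at the vertex, every half-arc met is an entering one
    from the orbit of \<open>arc_rot\<close> or the successor of such a one; the successors are
    leaving.\<close>
  have inv: "h \<in> Entering ` orbit arc_rot a \<union> \<sigma> ` Entering ` orbit arc_rot a"
    if "h \<in> orbit \<sigma> (Entering a)" for h
    using that
  proof induction
    case base
    then show ?case using permutation_self_in_orbit[OF p] by blast
  next
    case (step h)
    then consider e where "e \<in> orbit arc_rot a" "h = Entering e"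
      | e where "e \<in> orbit arc_rot a" "h = \<sigma> (Entering e)" by blast
    then show ?case
    proof cases
      case (2 e)
      then have "\<sigma> h = Entering (arc_rot e)" using \<sigma>_\<sigma>_Entering(1)[OF sub] by simp
      then show ?thesis using orbit.step[OF 2(1)] by blast
    qed blast
  qed
  show ?thesis
  proof (intro equalityI subsetI)
    fix e assume "e \<in> orbit arc_rot a"
    then have "Entering e \<in> orbit \<sigma> (Entering a)"
    proof induction
      case base
      show ?case
        unfolding \<sigma>_\<sigma>_Entering(1)[OF assms, symmetric] by (rule orbit.step[OF orbit.base])
    next
      case (step e)
      show ?case
        unfolding \<sigma>_\<sigma>_Entering(1)[OF sub[OF step(1)], symmetric]
        by (rule orbit.step[OF orbit.step[OF step(2)]])
    qed
    then show "e \<in> {e \<in> arcs D. head D e = head D a}"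
      unfolding H by (auto simp: half_arcs_at_def half_arcs_def)
  next
    fix e assume e: "e \<in> {e \<in> arcs D. head D e = head D a}"
    then have "Entering e \<in> orbit \<sigma> (Entering a)"
      unfolding H by (simp add: half_arcs_at_def half_arcs_def)
    from inv[OF this] show "e \<in> orbit arc_rot a"
      using \<sigma>_Entering(1)[OF sub] by auto
  qed
qed

lemma permutation_next: "permutation (proface_next \<sigma>)" "permutation (antiface_next \<sigma>)"
  using proface_next_permutes antiface_next_permutes finite_arcs permutation_permutes by blast+

lemma card_profaces: "card (profaces D \<sigma>) = orbit_count (arcs D) (proface_next \<sigma>)"
  unfolding profaces_def by (rule card_faces[OF permutation_next(1)])

lemma card_antifaces: "card (antifaces D \<sigma>) = orbit_count (arcs D) (antiface_next \<sigma>)"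
  unfolding antifaces_def by (rule card_faces[OF permutation_next(2)])

lemma orbit_count_arc_rot:
  assumes "head D ` arcs D = verts D"
  shows "orbit_count (arcs D) arc_rot = card (verts D)"
proof -
  let ?I = "\<lambda>v. {e \<in> arcs D. head D e = v}"
  have "orbit arc_rot ` arcs D = ?I ` verts D"
    unfolding assms[symmetric] image_image by (intro image_cong refl orbit_arc_rot)
  moreover have "inj_on ?I (verts D)"
  proof (rule inj_onI)
    fix v w assume "v \<in> verts D" and eq: "?I v = ?I w"
    then have "v \<in> head D ` arcs D" by (simp only: assms)
    then obtain e where e: "e \<in> arcs D" "v = head D e" by (elim imageE)
    then have "e \<in> ?I w" unfolding eq[symmetric] by blast
    then show "v = w" unfolding e(2) by blast
  qed
  ultimately show ?thesis unfolding orbit_count_def by (simp only: card_image)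
qed

text \<open>Profaces, vertices and antifaces are the orbits of \<open>proface_next \<sigma>\<close>,
  of \<open>arc_rot\<close> and of their composite, so \<open>orbit_count_comp_parity\<close>
  relates their numbers.\<close>

lemma faces_parity:
  assumes "head D ` arcs D = verts D"
  shows "even (card (profaces D \<sigma>) + card (antifaces D \<sigma>) + card (verts D) + card (arcs D))"
  using orbit_count_comp_parity[OF finite_arcs proface_next_permutes arc_rot_permutes]
  unfolding antiface_next_eq[symmetric] orbit_count_arc_rot[OF assms] card_profaces card_antifaces
  by presburger

lemma mem_faces:
  assumes "a \<in> arcs D"
  shows "\<exists>c \<in> profaces D \<sigma>. a \<in> circuit_arcs c" "\<exists>c \<in> antifaces D \<sigma>. a \<in> circuit_arcs c"
proof -
  have "a \<in> set (support (proface_next \<sigma>) a)" "a \<in> set (support (antiface_next \<sigma>) a)"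
    unfolding set_support[OF permutation_next(1)] set_support[OF permutation_next(2)]
    by (intro permutation_self_in_orbit permutation_next)+
  then show "\<exists>c \<in> profaces D \<sigma>. a \<in> circuit_arcs c" "\<exists>c \<in> antifaces D \<sigma>. a \<in> circuit_arcs c"
    using assms unfolding profaces_def antifaces_def
    by (metis (no_types, lifting) circuit_arcs_cyclic_class image_eqI)+
qed

end

section \<open>From circuit decompositions to rotation systems and back\<close>

lemma cas_tails_heads:
  "pre_digraph.cas D u p v \<Longrightarrow> u # map (head D) p = map (tail D) p @ [v]"
  by (induction p arbitrary: u) (auto simp: pre_digraph.cas.simps)

lemma directed_circuitE:
  assumes "directed_circuit D c"
  obtains q where "distinct q" "q \<noteq> []" "set q \<subseteq> arcs D" "c = cyclic_class q"
    "map (head D) q = rotate1 (map (tail D) q)"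
proof -
  obtain u q where q: "pre_digraph.trail D u q u" "q \<noteq> []" "c = cyclic_class q"
    using assms by (auto simp: directed_circuit_def)
  then have "distinct q" "set q \<subseteq> arcs D" "pre_digraph.cas D u q u"
    by (auto simp: pre_digraph.trail_def pre_digraph.awalk_def)
  moreover from cas_tails_heads[OF this(3)] have "map (head D) q = rotate1 (map (tail D) q)"
    using q(2) by (cases q) auto
  ultimately show ?thesis using that q by blast
qed

text \<open>The circuits partition the arcs, so the cyclic shifts along chosen representatives
  \<open>q c\<close> fit together to one permutation.\<close>

lemma circuit_decomposition_permutation:
  assumes fin: "finite (arcs D)" and C: "circuit_decomposition D C"
  obtains \<pi> where "\<pi> permutes arcs D" "\<And>a. a \<in> arcs D \<Longrightarrow> tail D (\<pi> a) = head D a"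
    "(\<lambda>a. cyclic_class (support \<pi> a)) ` arcs D = C"
proof -
  let ?A = "arcs D"
  have "\<exists>q. distinct q \<and> q \<noteq> [] \<and> set q \<subseteq> arcs D \<and> c = cyclic_class q \<and>
    map (head D) q = rotate1 (map (tail D) q)" if "c \<in> C" for c
    using C that directed_circuitE[of D c] unfolding circuit_decomposition_def by metis
  then obtain q where q: "\<And>c. c \<in> C \<Longrightarrow> distinct (q c)" "\<And>c. c \<in> C \<Longrightarrow> q c \<noteq> []"
    "\<And>c. c \<in> C \<Longrightarrow> set (q c) \<subseteq> ?A" "\<And>c. c \<in> C \<Longrightarrow> c = cyclic_class (q c)"
    "\<And>c. c \<in> C \<Longrightarrow> map (head D) (q c) = rotate1 (map (tail D) (q c))"
    by metis
  have arcs: "circuit_arcs c = set (q c)" if "c \<in> C" for c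
    using q(4)[OF that] circuit_arcs_cyclic_class by metis
  have ex1: "\<exists>!c. c \<in> C \<and> a \<in> set (q c)" if "a \<in> ?A" for a
    using C that arcs unfolding circuit_decomposition_def by metis
  define cl where "cl a = (THE c. c \<in> C \<and> a \<in> set (q c))" for a
  have cl: "cl a \<in> C" "a \<in> set (q (cl a))" if "a \<in> ?A" for a
    using theI'[OF ex1[OF that]] unfolding cl_def by blast+
  have cl_eq: "cl a = c" if "c \<in> C" "a \<in> set (q c)" for a c
  proof -
    have "a \<in> ?A" using q(3) that by blast
    then show ?thesis using ex1[of a] cl[of a] that by blast
  qed
  define \<pi> where "\<pi> a = (if a \<in> ?A then cycle_of_list (q (cl a)) a else a)" for a
  have map_\<pi>: "map \<pi> (q c) = rotate1 (q c)" if "c \<in> C" for c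
  proof -
    have "map \<pi> (q c) = map (cycle_of_list (q c)) (q c)"
      using q(3)[OF that] cl_eq[OF that] by (intro map_cong) (auto simp: \<pi>_def)
    also have "\<dots> = rotate1 (q c)" using cyclic_rotation[OF q(1)[OF that], of 1] by simp
    finally show ?thesis .
  qed
  have \<pi>_in: "\<pi> a \<in> set (q c)" if "c \<in> C" "a \<in> set (q c)" for a c
  proof -
    have "\<pi> a \<in> set (map \<pi> (q c))" using that(2) by simp
    then show ?thesis unfolding map_\<pi>[OF that(1)] by simp
  qed
  have perm: "\<pi> permutes ?A"
  proof (rule bij_imp_permutes)
    have "inj_on \<pi> ?A"
    proof (rule inj_onI)
      fix a b assume ab: "a \<in> ?A" "b \<in> ?A" "\<pi> a = \<pi> b"
      have "cl (\<pi> a) = cl a" "cl (\<pi> b) = cl b"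
        using cl_eq[OF cl(1) \<pi>_in[OF cl]] ab(1,2) by blast+
      then have "cl a = cl b" using ab(3) by simp
      then have "cycle_of_list (q (cl a)) a = cycle_of_list (q (cl a)) b"
        using ab unfolding \<pi>_def by simp
      then show "a = b" using permutes_inj[OF cycle_permutes, THEN injD] by metis
    qed
    moreover have "\<pi> ` ?A \<subseteq> ?A"
      using q(3)[OF cl(1)] \<pi>_in[OF cl] by blast
    ultimately show "bij_betw \<pi> ?A ?A"
      using endo_inj_surj[OF fin] by (simp add: bij_betw_def)
  qed (simp add: \<pi>_def)
  then have p: "permutation \<pi>" using fin permutation_permutes by blast
  have tail: "tail D (\<pi> a) = head D a" if "a \<in> ?A" for a
  proof -
    let ?q = "q (cl a)"
    have "map (\<lambda>b. tail D (\<pi> b)) ?q = map (tail D) (map \<pi> ?q)" by simp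
    also have "\<dots> = map (head D) ?q"
      by (simp only: map_\<pi>[OF cl(1)[OF that]] q(5)[OF cl(1)[OF that]] rotate1_map)
    finally show ?thesis using cl(2)[OF that] by (simp only: map_eq_conv)
  qed
  have face: "cyclic_class (support \<pi> a) = c" if "c \<in> C" "a \<in> set (q c)" for a c
    unfolding cyclic_class_support_eq[OF p q(1)[OF that(1)] map_\<pi>[OF that(1)] that(2)]
    by (rule q(4)[OF that(1), symmetric])
  have "(\<lambda>a. cyclic_class (support \<pi> a)) ` ?A = C"
  proof (intro equalityI subsetI)
    fix c assume "c \<in> (\<lambda>a. cyclic_class (support \<pi> a)) ` ?A"
    then obtain a where a: "a \<in> ?A" "c = cyclic_class (support \<pi> a)" by (elim imageE)
    then have "c = cl a" using face[OF cl[OF a(1)]] by simp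
    then show "c \<in> C" using cl(1)[OF a(1)] by simp
  next
    fix c assume c: "c \<in> C"
    then have "hd (q c) \<in> set (q c)" using q(2) by simp
    then have "hd (q c) \<in> ?A" "c = cyclic_class (support \<pi> (hd (q c)))"
      using face[OF c] q(3)[OF c] by blast+
    then show "c \<in> (\<lambda>a. cyclic_class (support \<pi> a)) ` ?A" by (rule rev_image_eqI)
  qed
  with perm tail show ?thesis by (rule that)
qed

context rotation_system
begin

lemma embedding_of_rot:
  fixes D :: "('a, 'b) pre_digraph"
  assumes A: "A = arcs D" and h: "h = head D" and t: "\<And>a. a \<in> A \<Longrightarrow> tail D (\<pi> a) = h a"
    and rot: "rot \<tau>"
  obtains \<rho> where "oriented_directed_embedding D \<rho>" "proface_next \<rho> = \<pi>" "antiface_next \<rho> = \<pi> \<circ> \<tau>"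
proof -
  \<comment> \<open>Profaces require the half-arc leaving on \<open>\<pi> a\<close> to precede the
    one entering on \<open>a\<close>, which fixes the successor of a leaving half-arc. Since
    \<open>\<tau> a\<close> is to be the next entering arc after \<open>a\<close>, the half-arc
    between them has to leave on \<open>\<pi> (\<tau> a)\<close>.\<close>
  define f where "f = (\<lambda>x. case x of Leaving b \<Rightarrow> Entering (inv \<pi> b) | Entering a \<Rightarrow> Leaving (\<pi> (\<tau> a)))"
  define \<rho> where "\<rho> x = (if x \<in> half_arcs D then f x else x)" for x
  have half: "Leaving a \<in> half_arcs D \<longleftrightarrow> a \<in> A" "Entering a \<in> half_arcs D \<longleftrightarrow> a \<in> A" for a
    by (auto simp: half_arcs_def A)
  have fin_half: "finite (half_arcs D)" using finA by (simp add: half_arcs_def A)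
  have \<tau>A: "\<tau> permutes A" using rot by (simp add: rot_def)
  have in_A: "\<pi> a \<in> A" "inv \<pi> a \<in> A" "\<tau> a \<in> A" if "a \<in> A" for a
    using that permutes_in_image[OF \<pi>] permutes_in_image[OF permutes_inv[OF \<pi>]]
      permutes_in_image[OF \<tau>A] by auto
  have \<rho>E: "\<rho> (Entering a) = Leaving (\<pi> (\<tau> a))" if "a \<in> A" for a
    using that half by (simp add: \<rho>_def f_def)
  have \<rho>L: "\<rho> (Leaving a) = Entering (inv \<pi> a)" if "a \<in> A" for a
    using that half by (simp add: \<rho>_def f_def)
  have \<rho>_half: "\<rho> x \<in> half_arcs D" if "x \<in> half_arcs D" for x
    using that by (cases x) (simp_all add: half \<rho>E \<rho>L in_A)
  have perm: "\<rho> permutes half_arcs D"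
  proof (rule bij_imp_permutes)
    have "inj_on \<rho> (half_arcs D)"
    proof (rule inj_onI)
      fix x y assume "x \<in> half_arcs D" "y \<in> half_arcs D" "\<rho> x = \<rho> y"
      then show "x = y"
        using permutes_inj[OF \<pi>] permutes_inj[OF \<tau>A] permutes_inj[OF permutes_inv[OF \<pi>]]
        by (cases x; cases y) (simp_all add: half \<rho>E \<rho>L inj_eq)
    qed
    moreover have "\<rho> ` half_arcs D \<subseteq> half_arcs D" using \<rho>_half by blast
    ultimately show "bij_betw \<rho> (half_arcs D) (half_arcs D)"
      using endo_inj_surj[OF fin_half] by (simp add: bij_betw_def)
  qed (simp add: \<rho>_def)
  have \<rho>\<rho>: "\<rho> (\<rho> (Entering a)) = Entering (\<tau> a)" if "a \<in> A" for a
    using \<rho>E \<rho>L in_A that permutes_inverses(2)[OF \<pi>] by simp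
  have h_\<tau>: "h (\<tau> a) = h a" if "a \<in> A" for a
    using rot_apply[OF rot, of a "h a"] that by (simp add: fibre_iff)
  have h_inv: "h (inv \<pi> b) = tail D b" if "b \<in> A" for b
    using t[OF in_A(2)[OF that]] permutes_inverses(1)[OF \<pi>] by simp
  \<comment> \<open>Every arc leaving a vertex follows some arc entering it, so reaching all
    entering half-arcs is enough to reach the whole vertex.\<close>
  have pred: "\<exists>e \<in> A. \<pi> (\<tau> e) = b \<and> h e = tail D b" if "b \<in> A" for b
  proof -
    have e: "inv \<tau> (inv \<pi> b) \<in> A"
      using in_A(2)[OF that] permutes_in_image[OF permutes_inv[OF \<tau>A]] by blast
    have "\<tau> (inv \<tau> (inv \<pi> b)) = inv \<pi> b" by (rule permutes_inverses(1)[OF \<tau>A])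
    then show ?thesis
      using e h_\<tau>[OF e] h_inv[OF that] permutes_inverses(1)[OF \<pi>] by (intro bexI[OF _ e]) simp
  qed
  have cyc: "cyclic_on \<rho> (half_arcs_at D v)" if ne: "half_arcs_at D v \<noteq> {}" for v
  proof -
    have mem: "Entering a \<in> half_arcs_at D v \<longleftrightarrow> a \<in> A \<and> h a = v"
      "Leaving a \<in> half_arcs_at D v \<longleftrightarrow> a \<in> A \<and> tail D a = v" for a
      by (auto simp: half_arcs_at_def half h)
    have step_E: "\<rho> (Entering e) \<in> half_arcs_at D v" if "e \<in> A" "h e = v" for e
      using that in_A(3)[OF that(1)] in_A(1)[OF in_A(3)[OF that(1)]] t[OF in_A(3)[OF that(1)]]
        h_\<tau>[OF that(1)] mem(2)[of "\<pi> (\<tau> e)"] \<rho>E[OF that(1)] by simp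
    obtain x where x: "x \<in> half_arcs_at D v" using ne by blast
    have "\<exists>a. a \<in> A \<and> h a = v"
    proof (cases x)
      case (Leaving b)
      then have "b \<in> A" "tail D b = v" using x mem(2)[of b] by simp_all
      then show ?thesis using pred[of b] by blast
    next
      case (Entering a)
      then show ?thesis using x mem(1)[of a] by (intro exI[of _ a]) simp
    qed
    then obtain a where a: "a \<in> A" "h a = v" by blast
    have E: "Entering e \<in> orbit \<rho> (Entering a)" if "e \<in> A" "h e = v" for e
    proof -
      have "e \<in> orbit \<tau> a" using rot_fibre_eq[OF rot, of a v] a that by (simp add: fibre_iff)
      then show ?thesis
      proof induction
        case base
        show ?case unfolding \<rho>\<rho>[OF a(1), symmetric] by (rule orbit.step[OF orbit.base])
      next
        case (step e)
        then have "e \<in> A" using permutes_orbit_subset[OF \<tau>A a(1)] by blast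
        show ?case unfolding \<rho>\<rho>[OF \<open>e \<in> A\<close>, symmetric] by (rule orbit.step[OF orbit.step[OF step(2)]])
      qed
    qed
    have "orbit \<rho> (Entering a) = half_arcs_at D v"
    proof (intro equalityI subsetI)
      fix y assume "y \<in> orbit \<rho> (Entering a)"
      then show "y \<in> half_arcs_at D v"
      proof induction
        case base
        show ?case by (rule step_E[OF a])
      next
        case (step y)
        show ?case
        proof (cases y)
          case (Leaving b)
          then have b: "b \<in> A" "tail D b = v" using step(2) mem(2)[of b] by simp_all
          then show ?thesis
            using \<rho>L[OF b(1)] Leaving h_inv[OF b(1)] in_A(2)[OF b(1)] mem(1)[of "inv \<pi> b"] by simp
        next
          case (Entering e)
          then have "e \<in> A" "h e = v" using step(2) mem(1)[of e] by simp_all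
          then show ?thesis using step_E[of e] Entering by simp
        qed
      qed
    next
      fix y assume y: "y \<in> half_arcs_at D v"
      show "y \<in> orbit \<rho> (Entering a)"
      proof (cases y)
        case (Leaving b)
        then have "b \<in> A" "tail D b = v" using y mem(2)[of b] by simp_all
        then obtain e where e: "e \<in> A" "\<pi> (\<tau> e) = b" "h e = v" using pred[of b] by blast
        have "\<rho> (Entering e) \<in> orbit \<rho> (Entering a)" by (rule orbit.step[OF E[OF e(1,3)]])
        then show ?thesis using \<rho>E[OF e(1)] e(2) Leaving by simp
      next
        case (Entering e)
        then show ?thesis using E[of e] y mem(1)[of e] by simp
      qed
    qed
    moreover have "Entering a \<in> half_arcs_at D v" using a mem(1)[of a] by simp
    ultimately show ?thesis by (intro cyclic_on_singleI[of "Entering a"]) simp_all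
  qed
  have alt: "is_Leaving (\<rho> x) \<longleftrightarrow> \<not> is_Leaving x" if "x \<in> half_arcs D" for x
    using that by (cases x) (simp_all add: half \<rho>E \<rho>L)
  have "oriented_directed_embedding D \<rho>"
    unfolding oriented_directed_embedding_def using perm cyc alt by blast
  moreover have "proface_next \<rho> = \<pi>"
  proof
    fix a
    show "proface_next \<rho> a = \<pi> a"
    proof (cases "a \<in> A")
      case True
      have "\<rho> (Leaving (\<pi> a)) = Entering a"
        using \<rho>L[OF in_A(1)[OF True]] permutes_inverses(2)[OF \<pi>] by simp
      then have "inv \<rho> (Entering a) = Leaving (\<pi> a)" using permutes_inv_eq[OF perm] by blast
      then show ?thesis by (simp add: proface_next_def)
    next
      case False
      then have "inv \<rho> (Entering a) = Entering a"
        using permutes_not_in[OF permutes_inv[OF perm]] half by blast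
      then show ?thesis using permutes_not_in[OF \<pi> False] by (simp add: proface_next_def)
    qed
  qed
  moreover have "antiface_next \<rho> = \<pi> \<circ> \<tau>"
  proof
    fix a
    show "antiface_next \<rho> a = (\<pi> \<circ> \<tau>) a"
    proof (cases "a \<in> A")
      case False
      then show ?thesis
        using permutes_not_in[OF \<pi> False] permutes_not_in[OF \<tau>A False] half
        by (simp add: antiface_next_def \<rho>_def)
    qed (simp add: antiface_next_def \<rho>E)
  qed
  ultimately show ?thesis by (rule that)
qed

end

section \<open>Degree and connectedness hypotheses, and the final embedding\<close>

lemma out_degree_underlying_simple:
  "out_degree (with_proj (underlying_simple D)) v =
     card {u. u \<noteq> v \<and> (\<exists>g \<in> arcs D. tail D g = u \<and> head D g = v \<or> tail D g = v \<and> head D g = u)}"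
proof -
  let ?S = "{u. u \<noteq> v \<and> (\<exists>g \<in> arcs D. tail D g = u \<and> head D g = v \<or> tail D g = v \<and> head D g = u)}"
  have "out_arcs (with_proj (underlying_simple D)) v = Pair v ` ?S"
    by (auto simp: out_arcs_def underlying_simple_def parcs_mk_symmetric image_iff)
  then show ?thesis by (simp add: out_degree_def card_image inj_on_def)
qed

lemma connected_closed_eq:
  assumes conn: "Digraph_Component.connected D" and W: "W \<subseteq> verts D" "W \<noteq> {}"
    and closed: "\<And>g. g \<in> arcs D \<Longrightarrow> tail D g \<in> W \<longleftrightarrow> head D g \<in> W"
  shows "W = verts D"
proof -
  obtain w where w: "w \<in> W" using W(2) by blast
  have "v \<in> W" if "v \<in> verts D" for v
  proof -
    have "(w, v) \<in> rtrancl_on (verts D) ((arcs_ends D)\<^sup>s)"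
      using conn that w W(1) unfolding connected_conv by blast
    then show ?thesis
    proof (induction rule: rtrancl_on_induct)
      case base
      show ?case by (rule w)
    next
      case (step y z)
      then have "(y, z) \<in> arcs_ends D \<or> (z, y) \<in> arcs_ends D" unfolding symcl_def by auto
      then obtain g where "g \<in> arcs D" "tail D g = y \<and> head D g = z \<or> tail D g = z \<and> head D g = y"
        unfolding arcs_ends_def arc_to_ends_def by blast
      then show ?case using closed[of g] step by auto
    qed
  qed
  then show ?thesis using W(1) by blast
qed

theorem theorem4p1:
  fixes D :: "('a, 'b) pre_digraph" and C :: "'b list set set" and n :: nat
  assumes "eulerian_digraph D"
    and "card (verts D) = n"
    and "real (min_degree (underlying_simple D)) \<ge> (4 * real n + 2) / 5"
    and "circuit_decomposition D C"
  shows "\<exists>\<rho>. oriented_directed_embedding D \<rho> \<and>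
           profaces D \<rho> = C \<and>
           card (antifaces D \<rho>) =
             (if odd (card (verts D) + card (arcs D) + card C) then 1 else 2) \<and>
           (\<forall>\<sigma>. oriented_directed_embedding D \<sigma> \<and> C \<subseteq> profaces D \<sigma> \<union> antifaces D \<sigma> \<longrightarrow>
                genus D \<sigma> \<le> genus D \<rho>)"
proof -
  interpret fin_digraph D using assms(1) by (simp add: eulerian_digraph_def)
  have conn: "Digraph_Component.connected D" and euler: "\<And>v. v \<in> verts D \<Longrightarrow> in_degree D v = out_degree D v"
    using assms(1) by (auto simp: eulerian_digraph_def)
  have "verts D \<noteq> {}" using conn unfolding connected_conv by blast
  define nbrs where "nbrs v = {u. u \<noteq> v \<and>
    (\<exists>g \<in> arcs D. tail D g = u \<and> head D g = v \<or> tail D g = v \<and> head D g = u)}" for v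
  define \<delta> where "\<delta> = min_degree (underlying_simple D)"
  have nbrs_V: "nbrs v \<subseteq> verts D - {v}" for v
    unfolding nbrs_def using wellformed by blast
  have deg: "\<delta> \<le> card (nbrs v)" if "v \<in> verts D" for v
  proof -
    have "\<delta> \<le> out_degree (with_proj (underlying_simple D)) v"
      unfolding \<delta>_def min_degree_def using that by (intro Min_le) (auto simp: underlying_simple_def)
    then show ?thesis by (simp only: out_degree_underlying_simple nbrs_def)
  qed
  have nbrs_card: "card (nbrs v) \<le> n - 1" if "v \<in> verts D" for v
    using card_mono[OF _ nbrs_V, of v] that assms(2) by simp
  have n\<delta>: "4 * n + 2 \<le> 5 * \<delta>"
  proof -
    have "real (4 * n + 2) \<le> real (5 * \<delta>)" using assms(3) unfolding \<delta>_def by simp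
    then show ?thesis by (simp only: of_nat_le_iff)
  qed
  obtain v0 where v0: "v0 \<in> verts D" using \<open>verts D \<noteq> {}\<close> by blast
  have \<delta>n: "\<delta> \<le> n - 1" using deg[OF v0] nbrs_card[OF v0] by simp
  \<comment> \<open>The degree bound gives each vertex an incident arc, and equality of indegree and
    outdegree turns this into an entering one.\<close>
  have heads: "head D ` arcs D = verts D"
  proof (intro equalityI subsetI)
    fix v assume v: "v \<in> verts D"
    have "card (nbrs v) > 0" using deg[OF v] n\<delta> by simp
    then obtain u where "u \<in> nbrs v" by (metis card_gt_0_iff ex_in_conv)
    then have "in_arcs D v \<noteq> {} \<or> out_arcs D v \<noteq> {}"
      unfolding nbrs_def in_arcs_def out_arcs_def by blast
    then have "0 < in_degree D v \<or> 0 < out_degree D v"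
      by (auto simp: in_degree_def out_degree_def card_gt_0_iff)
    then have "in_arcs D v \<noteq> {}" using euler[OF v] by (auto simp: in_degree_def)
    then show "v \<in> head D ` arcs D" by (auto simp: in_arcs_def)
  qed auto
  obtain \<pi> where pi: "\<pi> permutes arcs D" "\<And>a. a \<in> arcs D \<Longrightarrow> tail D (\<pi> a) = head D a"
    "(\<lambda>a. cyclic_class (support \<pi> a)) ` arcs D = C"
    using circuit_decomposition_permutation[OF finite_arcs assms(4)] by blast
  \<comment> \<open>A vertex has at most \<open>n - 1 - \<delta>\<close> non-neighbours, and
    \<open>4 * n + 2 \<le> 5 * \<delta>\<close> says exactly that five times this number is at most
    \<open>n - 7\<close>.\<close>
  interpret dense_rotation_system "arcs D" "head D" \<pi> "tail D" "verts D" "n - 1 - \<delta>"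
  proof unfold_locales
    show "5 * (n - 1 - \<delta>) + 7 \<le> card (verts D)" using n\<delta> \<delta>n assms(2) by simp
    fix v assume v: "v \<in> verts D"
    have "{u \<in> verts D. u \<noteq> v \<and> \<not> (\<exists>g \<in> arcs D. tail D g = u \<and> head D g = v \<or> tail D g = v \<and> head D g = u)}
      = verts D - {v} - nbrs v" unfolding nbrs_def by blast
    moreover have "card (verts D - {v} - nbrs v) = n - 1 - card (nbrs v)"
      using nbrs_V[of v] v assms(2) finite_subset[OF nbrs_V[of v]] by (simp add: card_Diff_subset)
    ultimately show "card {u \<in> verts D. u \<noteq> v \<and>
        \<not> (\<exists>g \<in> arcs D. tail D g = u \<and> head D g = v \<or> tail D g = v \<and> head D g = u)} \<le> n - 1 - \<delta>"
      using deg[OF v] by simp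
  next
    fix W assume "W \<subseteq> verts D" "W \<noteq> {}" "\<And>g. g \<in> arcs D \<Longrightarrow> tail D g \<in> W \<longleftrightarrow> head D g \<in> W"
    then show "W = verts D" by (rule connected_closed_eq[OF conn])
  qed (use pi(1,2) in auto)
  obtain \<tau> where \<tau>: "rotmin \<tau>" using rotmin_ex by blast
  then have rot: "rot \<tau>" by (simp add: rotmin_def)
  obtain \<rho> where \<rho>: "oriented_directed_embedding D \<rho>" "proface_next \<rho> = \<pi>" "antiface_next \<rho> = \<pi> \<circ> \<tau>"
    using embedding_of_rot[OF refl refl pi(2) rot] by blast
  interpret E: embedded_digraph D \<rho> using \<rho>(1) by unfold_locales
  have pro: "profaces D \<rho> = C" unfolding profaces_def \<rho>(2) by (rule pi(3))
  obtain a where a: "a \<in> arcs D" using heads v0 by blast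
  have anti: "card (antifaces D \<rho>) = (if odd (card (verts D) + card (arcs D) + card C) then 1 else 2)"
  proof -
    have "card (antifaces D \<rho>) \<le> 2"
      unfolding E.card_antifaces \<rho>(3) by (rule rotmin_at_most_two_faces[OF \<tau>])
    moreover have "card (antifaces D \<rho>) > 0"
      using a by (auto simp: antifaces_def card_gt_0_iff)
    moreover have "even (card C + card (antifaces D \<rho>) + card (verts D) + card (arcs D))"
      using E.faces_parity[OF heads] unfolding pro .
    ultimately show ?thesis by (cases "card (antifaces D \<rho>) = 1"; cases "card (antifaces D \<rho>) = 2") auto
  qed
  have "genus D \<sigma> \<le> genus D \<rho>"
    if \<sigma>: "oriented_directed_embedding D \<sigma>" "C \<subseteq> profaces D \<sigma> \<union> antifaces D \<sigma>" for \<sigma>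
  proof -
    interpret S: embedded_digraph D \<sigma> using \<sigma>(1) by unfold_locales
    let ?P = "profaces D \<sigma>" and ?Q = "antifaces D \<sigma>"
    have fin: "finite ?P" "finite ?Q" by (simp_all add: profaces_def antifaces_def)
    have PQ: "card ?P + card ?Q = card (?P \<union> ?Q) + card (?P \<inter> ?Q)"
      by (rule card_Un_Int[OF fin])
    have le: "card C \<le> card (?P \<union> ?Q)" using \<sigma>(2) fin by (intro card_mono) auto
    \<comment> \<open>In case of equality the faces would be exactly the circuits of
      \<open>C\<close>, none of them bounding both a proface and an antiface. But the arc
      \<open>a\<close> lies on a proface and on an antiface, while only one circuit of
      \<open>C\<close> contains it.\<close>
    have "card C < card ?P + card ?Q"
    proof (rule ccontr)
      assume "\<not> ?thesis"
      then have "card (?P \<inter> ?Q) = 0" "card C = card (?P \<union> ?Q)" using PQ le by simp_all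
      then have disj: "?P \<inter> ?Q = {}" and eq: "C = ?P \<union> ?Q"
        using fin \<sigma>(2) card_subset_eq[of "?P \<union> ?Q" C] by simp_all
      obtain c d where cd: "c \<in> ?P" "a \<in> circuit_arcs c" "d \<in> ?Q" "a \<in> circuit_arcs d"
        using S.mem_faces[OF a] by blast
      have "\<exists>!c. c \<in> C \<and> a \<in> circuit_arcs c"
        using assms(4) a by (simp add: circuit_decomposition_def)
      then have "c = d" using cd eq by blast
      then show False using cd disj by blast
    qed
    moreover have "even (card ?P + card ?Q + card (verts D) + card (arcs D))"
      by (rule S.faces_parity[OF heads])
    \<comment> \<open>There is at least one face beyond those of \<open>C\<close>, and at least two
      if the parity excludes one. So no competitor has fewer faces, which means that none has larger
      genus.\<close>
    moreover have arith: "c + (if odd (m + c) then 1 else 2) \<le> f" if "c < f" "even (f + m)" for c f m :: nat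
      using that by (cases "f = c + 1") auto
    ultimately have "card C + card (antifaces D \<rho>) \<le> card ?P + card ?Q"
      using anti arith[of "card C" "card ?P + card ?Q" "card (verts D) + card (arcs D)"]
      by (simp add: add.assoc add.commute[of _ "card C"])
    then show ?thesis by (simp add: genus_def euler_characteristic_def pro)
  qed
  then show ?thesis using \<rho>(1) pro anti by blast
qed

end
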